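(* Let $1\le b\le m-1$. Promotion $\partial$ acting on $\mathrm{SYT}_R(m-b,b)$ has exactly one orbit of size $m-1$, and all other orbits have sizes dividing $m$. In particular, if $\xi$ is a primitive $(m-1)$-th root of unity and $\zeta$ a primitive $m$-th root of unity, then for every integer $e$, \[ \#\{T:\partial^{me}(T)=T\}=\binom mb-m+[m-1]_{\xi^e},\qquad \#\{T:\partial^{(m-1)e}(T)=T\}=\genfrac{[}{]}{0pt}{}{m}{b}_{\zeta^e}-[m]_{\zeta^e}+m-1, \] where $T$ ranges over $\mathrm{SYT}_R(m-b,b)$; i.e. both $(\mathrm{SYT}_R(m-b,b),\langle\partial^m\rangle,\binom mb-m+[m-1]_q)$ and $(\mathrm{SYT}_R(m-b,b),\langle\partial^{m-1}\rangle,\genfrac{[}{]}{0pt}{}{m}{b}_q-[m]_q+m-1)$ are CSP-triples.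
   Context: $\mathrm{SYT}_R(m-b,b)$ is the set of standard Young tableaux (entries $1,\dots,m$, each once, rows increasing left to right, columns increasing downwards) of the two-row ribbon shape whose top row has $m-b$ boxes and bottom row has $b$ boxes, with the first box of the top row directly above the last box of the bottom row. Promotion $\partial$: replace $1$ by a dot; repeatedly swap the dot with the smaller of its right and lower neighbours in the shape until neither exists; decrement all entries by one and put $m$ in the dot's box. $[r]_q=1+q+\dots+q^{r-1}$ and $\genfrac{[}{]}{0pt}{}{m}{b}_q$ is the $q$-binomial coefficient. *)

theory Defs
  imports
    Complex_Main
    "HOL-Library.While_Combinator"
    "HOL-Combinatorics.Orbits"
    "HOL-Computational_Algebra.Polynomial"
begin

text \<open>
  Cells are pairs (row, column), in matrix coordinates: rows grow downwards and columns grow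
  to the right, both starting from 1. A filling of a shape is a function on all cells which is
  0 outside the shape, so that equality of functions is equality of fillings.
\<close>

type_synonym cell = "nat \<times> nat"

definition SYT :: "cell set \<Rightarrow> (cell \<Rightarrow> nat) set" where
  "SYT S = {T. bij_betw T S {1..card S} \<and> (\<forall>c. c \<notin> S \<longrightarrow> T c = 0) \<and>
     (\<forall>i j j'. (i, j) \<in> S \<and> (i, j') \<in> S \<and> j < j' \<longrightarrow> T (i, j) < T (i, j')) \<and>
     (\<forall>i i' j. (i, j) \<in> S \<and> (i', j) \<in> S \<and> i < i' \<longrightarrow> T (i, j) < T (i', j))}"

definition ribbon :: "nat \<Rightarrow> nat \<Rightarrow> cell set" where
  "ribbon a b = {1} \<times> {b..a + b - 1} \<union> {2} \<times> {1..b}"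

abbreviation SYT_R :: "nat \<Rightarrow> nat \<Rightarrow> (cell \<Rightarrow> nat) set" where
  "SYT_R a b \<equiv> SYT (ribbon a b)"

definition right_of :: "cell \<Rightarrow> cell" where
  "right_of c = (fst c, snd c + 1)"

definition below :: "cell \<Rightarrow> cell" where
  "below c = (fst c + 1, snd c)"

text \<open>
  The sliding state consists of the position of the dot and the current filling. The entry
  stored in the dot's cell is always the original 1, so swapping the dot with a neighbour
  is swapping two entries.
\<close>

definition slide_target :: "cell set \<Rightarrow> (cell \<Rightarrow> nat) \<Rightarrow> cell \<Rightarrow> cell" where
  "slide_target S T c =
     (if right_of c \<in> S \<and> (below c \<in> S \<longrightarrow> T (right_of c) < T (below c))
      then right_of c else below c)"

definition slide_step :: "cell set \<Rightarrow> cell \<times> (cell \<Rightarrow> nat) \<Rightarrow> cell \<times> (cell \<Rightarrow> nat)" where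
  "slide_step S = (\<lambda>(c, T). let d = slide_target S T c in (d, T(c := T d, d := T c)))"

definition slide :: "cell set \<Rightarrow> cell \<times> (cell \<Rightarrow> nat) \<Rightarrow> cell \<times> (cell \<Rightarrow> nat)" where
  "slide S = while (\<lambda>(c, T). right_of c \<in> S \<or> below c \<in> S) (slide_step S)"

definition promotion :: "cell set \<Rightarrow> (cell \<Rightarrow> nat) \<Rightarrow> (cell \<Rightarrow> nat)" where
  "promotion S T =
     (let (d, U) = slide S (THE c. c \<in> S \<and> T c = 1, T)
      in (\<lambda>c. if c = d then card S else if c \<in> S then U c - 1 else 0))"

definition int_iterate :: "'a set \<Rightarrow> ('a \<Rightarrow> 'a) \<Rightarrow> int \<Rightarrow> 'a \<Rightarrow> 'a" where
  "int_iterate X f k = (if k \<ge> 0 then f ^^ nat k else inv_into X f ^^ nat (- k))"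

definition q_int :: "nat \<Rightarrow> int poly" where
  "q_int r = (\<Sum>i<r. monom 1 i)"

definition q_fact :: "nat \<Rightarrow> int poly" where
  "q_fact n = (\<Prod>i=1..n. q_int i)"

definition q_binomial :: "nat \<Rightarrow> nat \<Rightarrow> int poly" where
  "q_binomial n k = (if k \<le> n then q_fact n div (q_fact k * q_fact (n - k)) else 0)"

definition q_eval :: "int poly \<Rightarrow> complex \<Rightarrow> complex" where
  "q_eval f z = poly (map_poly of_int f) z"

definition primitive_root_of_unity :: "nat \<Rightarrow> complex \<Rightarrow> bool" where
  "primitive_root_of_unity n z \<longleftrightarrow> 0 < n \<and> z ^ n = 1 \<and> (\<forall>k. 0 < k \<and> k < n \<longrightarrow> z ^ k \<noteq> 1)"

text \<open>
  The cyclic group of order n acts on X with a generator acting as g. The action need not be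
  faithful: n is a multiple of the order of the permutation g and may be a proper one.
\<close>

definition csp_triple :: "'a set \<Rightarrow> ('a \<Rightarrow> 'a) \<Rightarrow> nat \<Rightarrow> int poly \<Rightarrow> bool" where
  "csp_triple X g n f \<longleftrightarrow>
     finite X \<and> 0 < n \<and> bij_betw g X X \<and> (\<forall>x\<in>X. (g ^^ n) x = x) \<and>
     (\<forall>z. primitive_root_of_unity n z \<longrightarrow>
        (\<forall>e::int. of_nat (card {x \<in> X. int_iterate X g e x = x}) = q_eval f (z powi e)))"

text \<open>The division in the definition of the q-binomial coefficient is exact.\<close>

lemma q_int_add: "q_int (a + b) = q_int a + monom 1 a * q_int b"
proof -
  have "q_int (a + b) = q_int a + (\<Sum>i<b. monom 1 (a + i))"
    unfolding q_int_def by (induction b) (auto simp: algebra_simps)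
  then show ?thesis
    by (simp add: q_int_def sum_distrib_left mult_monom)
qed

lemma q_fact_Suc: "q_fact (Suc n) = q_fact n * q_int (Suc n)"
  by (simp add: q_fact_def)

lemma q_fact_dvd: "k \<le> n \<Longrightarrow> q_fact k * q_fact (n - k) dvd q_fact n"
proof (induction n arbitrary: k)
  case 0
  then show ?case by (simp add: q_fact_def)
next
  case (Suc n)
  show ?case
  proof (cases k)
    case 0
    then show ?thesis by (simp add: q_fact_def)
  next
    case k: (Suc l)
    show ?thesis
    proof (cases "k = Suc n")
      case True
      then show ?thesis by (simp add: q_fact_def)
    next
      case False
      with Suc.prems k have l: "l < n" by simp
      then obtain p where p: "n - l = Suc p" and n: "Suc n = Suc l + Suc p" and p': "n - Suc l = p"
        by (metis Suc_diff_Suc add_Suc le_add_diff_inverse less_imp_le_nat)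
      have 1: "q_fact l * q_fact (Suc p) dvd q_fact n"
        using Suc.IH[of l] l p by simp
      have 2: "q_fact (Suc l) * q_fact p dvd q_fact n"
        using Suc.IH[of "Suc l"] l p' by simp
      have "q_fact (Suc l) * q_fact (Suc p) dvd q_fact n * q_int (Suc l)"
        using mult_dvd_mono[OF 1 dvd_refl[of "q_int (Suc l)"]] by (simp add: q_fact_Suc ac_simps)
      moreover have "q_fact (Suc l) * q_fact (Suc p) dvd q_fact n * q_int (Suc p)"
        using mult_dvd_mono[OF 2 dvd_refl[of "q_int (Suc p)"]] by (simp add: q_fact_Suc ac_simps)
      then have "q_fact (Suc l) * q_fact (Suc p) dvd monom 1 (Suc l) * (q_fact n * q_int (Suc p))"
        by (rule dvd_mult)
      ultimately have "q_fact (Suc l) * q_fact (Suc p) dvd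
          q_fact n * q_int (Suc l) + monom 1 (Suc l) * (q_fact n * q_int (Suc p))"
        by (rule dvd_add)
      also have "\<dots> = q_fact n * q_int (Suc l + Suc p)"
        unfolding q_int_add by (simp only: algebra_simps)
      also have "\<dots> = q_fact (Suc n)"
        by (simp only: q_fact_Suc n[symmetric])
      finally show ?thesis using k p by simp
    qed
  qed
qed

lemma q_binomial_exact:
  "k \<le> n \<Longrightarrow> q_binomial n k * (q_fact k * q_fact (n - k)) = q_fact n"
  by (simp add: q_binomial_def q_fact_dvd)

end

theory Submission
  imports Defs
begin

text \<open>
  A tableau is determined by the set of its bottom entries, which can be any b-subset of
  \<open>{1..m}\<close> other than \<open>{1..b}\<close>. On these subsets promotion is the cyclic rotation
  \<open>x \<mapsto> x - 1\<close> modulo m, except that it jumps over the missing set \<open>{1..b}\<close>. The m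
  rotations of \<open>{1..b}\<close> are distinct, so removing one of them leaves a cycle of length
  \<open>m - 1\<close>, and on all other subsets promotion is plain rotation. The fixed points of rotations
  are counted by the q-binomial coefficient at roots of unity, through the q-Lucas recurrence
  \<open>[n + d, k] = [n, k] + [n, k - d]\<close> at a primitive d-th root of unity.

  Subsets of \<open>\<int>/m\<close> are represented by m-periodic predicates on the integers, which makes
  rotation by k the shift of the argument and turns fixed points into a statement about periods.
\<close>

section \<open>Periods and orbits\<close>

text \<open>The jump has a concrete source. If the slide turns down at the corner, the bottom
  entries are \<open>{2..b + 1}\<close>. Rotation would make them \<open>{1..b}\<close>, which the
  corner inequality forbids; the slide instead produces the rotation of \<open>{1..b}\<close>, so
  promotion rotates twice at this one place. Both counting formulas then read off term by term. The
  \<open>m\<close>-th power of promotion is trivial away from the arcs (the rotations of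
  \<open>{1..b}\<close>), which explains \<open>m choose b\<close> minus \<open>m\<close>. On the
  cycle of the remaining arcs it generates the same group as promotion, because \<open>m\<close> and
  \<open>m - 1\<close> are coprime; there it fixes all \<open>m - 1\<close> points or none, which is
  the value of \<open>q_int (m - 1)\<close>. The \<open>(m - 1)\<close>-th power fixes that cycle
  pointwise and acts elsewhere as the inverse rotation. The q-binomial counts all fixed words,
  \<open>q_int m\<close> removes the fixed arcs among them, and \<open>m - 1\<close> puts the cycle
  back.\<close>

lemma inv_into_funpow_fixed_iff:
  assumes "bij_betw p X X" and "x \<in> X"
  shows "(inv_into X p ^^ n) x = x \<longleftrightarrow> (p ^^ n) x = x"
proof -
  have X: "(p ^^ n) y \<in> X" "(inv_into X p ^^ n) y \<in> X" if "y \<in> X" for y n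
    using that assms(1) bij_betw_inv_into[OF assms(1)]
    by (induction n) (auto simp: bij_betw_def)
  have 1: "(inv_into X p ^^ n) ((p ^^ n) y) = y" if "y \<in> X" for y n
    using that
  proof (induction n arbitrary: y)
    case (Suc n)
    have "(inv_into X p ^^ Suc n) ((p ^^ Suc n) y)
        = (inv_into X p ^^ n) (inv_into X p (p ((p ^^ n) y)))"
      by (simp add: funpow_swap1)
    also have "\<dots> = (inv_into X p ^^ n) ((p ^^ n) y)"
      using bij_betw_inv_into_left[OF assms(1) X(1)[OF Suc.prems]] by simp
    finally show ?case using Suc by simp
  qed simp
  have 2: "(p ^^ n) ((inv_into X p ^^ n) y) = y" if "y \<in> X" for y n
    using that
  proof (induction n arbitrary: y)
    case (Suc n)
    have "(p ^^ Suc n) ((inv_into X p ^^ Suc n) y)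
        = (p ^^ n) (p (inv_into X p ((inv_into X p ^^ n) y)))"
      by (simp add: funpow_swap1)
    also have "\<dots> = (p ^^ n) ((inv_into X p ^^ n) y)"
      using bij_betw_inv_into_right[OF assms(1) X(2)[OF Suc.prems]] by simp
    finally show ?case using Suc by simp
  qed simp
  show ?thesis using 1[OF assms(2), of n] 2[OF assms(2), of n] by metis
qed

text \<open>A power of a bijection and its inverse have the same fixed points. This removes signed
  exponents from every count below.\<close>

lemma int_iterate_fixed_iff:
  assumes "bij_betw p X X" and "x \<in> X"
  shows "int_iterate X p k x = x \<longleftrightarrow> (p ^^ nat \<bar>k\<bar>) x = x"
  using inv_into_funpow_fixed_iff[OF assms] by (simp add: int_iterate_def)

lemma card_orbit_eq_period:
  assumes "0 < k" and period: "\<And>n. (p ^^ n) x = x \<longleftrightarrow> k dvd n"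
  shows "card (orbit p x) = k"
proof -
  have k: "(p ^^ k) x = x" using period by simp
  have "orbit p x = (\<lambda>i. (p ^^ i) x) ` {0..<k}"
  proof
    show "orbit p x \<subseteq> (\<lambda>i. (p ^^ i) x) ` {0..<k}"
    proof
      fix y assume "y \<in> orbit p x"
      then obtain n where "y = (p ^^ n) x" by (auto simp: orbit_altdef)
      then have "y = (p ^^ (n mod k)) x" using funpow_mod_eq[OF k] by simp
      then show "y \<in> (\<lambda>i. (p ^^ i) x) ` {0..<k}" using assms(1) by auto
    qed
    show "(\<lambda>i. (p ^^ i) x) ` {0..<k} \<subseteq> orbit p x"
    proof
      fix y assume "y \<in> (\<lambda>i. (p ^^ i) x) ` {0..<k}"
      then obtain i where "y = (p ^^ i) x" by auto
      \<comment> \<open>\<open>orbit\<close> consists of positive powers only; adding the period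
        \<open>k\<close> covers \<open>i = 0\<close>.\<close>
      then have "y = (p ^^ (i + k)) x" using k by (simp add: funpow_add)
      then show "y \<in> orbit p x" using assms(1) by (auto simp: orbit_altdef)
    qed
  qed
  moreover have "inj_on (\<lambda>i. (p ^^ i) x) {0..<k}"
  proof (rule linorder_inj_onI)
    fix i j assume ij: "i < j" "i \<in> {0..<k}" "j \<in> {0..<k}"
    show "(p ^^ i) x \<noteq> (p ^^ j) x"
    proof
      assume "(p ^^ i) x = (p ^^ j) x"
      \<comment> \<open>Going forward by \<open>k - i\<close> completes a period on the left side,
        so the coincidence becomes a return to \<open>x\<close> without inverting
        \<open>p\<close>.\<close>
      then have "(p ^^ (k - i)) ((p ^^ i) x) = (p ^^ (k - i)) ((p ^^ j) x)" by simp
      then have "(p ^^ (k - i + i)) x = (p ^^ (k - i + j)) x" by (simp only: funpow_add o_apply)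
      then have "(p ^^ (k + (j - i))) x = x" using ij k by (simp add: add.commute)
      then have "k dvd j - i" using period by simp
      then show False using ij by (auto dest: dvd_imp_le)
    qed
  qed auto
  ultimately show ?thesis by (simp add: card_image)
qed

lemma least_period_exists:
  assumes "(p ^^ m) x = x" and "0 < m"
  obtains k where "0 < k" and "\<And>n. (p ^^ n) x = x \<longleftrightarrow> k dvd n"
proof -
  define k where "k = (LEAST n. 0 < n \<and> (p ^^ n) x = x)"
  have k: "0 < k" "(p ^^ k) x = x"
    using LeastI[of "\<lambda>n. 0 < n \<and> (p ^^ n) x = x" m] assms by (auto simp: k_def)
  have least: "k \<le> n" if "0 < n" "(p ^^ n) x = x" for n
    unfolding k_def using that by (intro Least_le) simp
  have "(p ^^ n) x = x \<longleftrightarrow> k dvd n" for n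
  proof -
    have "(p ^^ n) x = (p ^^ (n mod k)) x" using funpow_mod_eq[OF k(2)] by simp
    moreover have "(p ^^ (n mod k)) x = x \<longleftrightarrow> n mod k = 0"
      using least[of "n mod k"] k(1) mod_less_divisor[OF k(1), of n] by auto
    ultimately show ?thesis by (auto simp: dvd_eq_mod_eq_0)
  qed
  then show thesis using that k(1) by blast
qed

section \<open>Gaussian binomials at roots of unity\<close>

lemma q_eval_pCons [simp]: "q_eval (pCons a f) z = of_int a + z * q_eval f z"
  by (simp add: q_eval_def map_poly_pCons)

lemma q_eval_0 [simp]: "q_eval 0 z = 0"
  by (simp add: q_eval_def)

lemma q_eval_add [simp]: "q_eval (f + g) z = q_eval f z + q_eval g z"
  by (induction f g rule: poly_induct2) (simp_all add: algebra_simps)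

lemma q_eval_smult [simp]: "q_eval (smult a f) z = of_int a * q_eval f z"
  by (induction f) (simp_all add: algebra_simps)

lemma q_eval_mult [simp]: "q_eval (f * g) z = q_eval f z * q_eval g z"
  by (induction f) (simp_all add: algebra_simps)

lemma q_eval_diff [simp]: "q_eval (f - g) z = q_eval f z - q_eval g z"
  using q_eval_add[of "f - g" g z] by (simp del: q_eval_add)

lemma q_eval_1 [simp]: "q_eval 1 z = 1"
  by (simp add: one_pCons)

lemma q_eval_of_nat [simp]: "q_eval (of_nat n) z = of_nat n"
  by (induction n) simp_all

lemma q_eval_monom [simp]: "q_eval (monom a n) z = of_int a * z ^ n"
  by (induction n) (simp_all add: monom_0 monom_Suc)

lemma q_eval_sum [simp]: "q_eval (sum f A) z = (\<Sum>i\<in>A. q_eval (f i) z)"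
  by (induction A rule: infinite_finite_induct) simp_all

lemma q_eval_prod [simp]: "q_eval (prod f A) z = (\<Prod>i\<in>A. q_eval (f i) z)"
  by (induction A rule: infinite_finite_induct) simp_all

lemma q_eval_q_int: "q_eval (q_int n) z = (\<Sum>i<n. z ^ i)"
  by (simp add: q_int_def)

lemma q_eval_q_int_root_of_unity:
  assumes "z ^ n = 1"
  shows "q_eval (q_int n) z = (if z = 1 then of_nat n else 0)"
  using assms geometric_sum[of z n] by (simp add: q_eval_q_int)

lemma q_int_neq_0: "0 < n \<Longrightarrow> q_int n \<noteq> 0"
proof
  assume "0 < n" "q_int n = 0"
  then have "q_eval (q_int n) 1 = 0" by simp
  then show False using \<open>0 < n\<close> by (simp add: q_eval_q_int)
qed

lemma q_fact_neq_0: "q_fact n \<noteq> 0"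
  by (simp add: q_fact_def q_int_neq_0)

lemma q_binomial_0 [simp]: "q_binomial n 0 = 1"
  using q_binomial_exact[of 0 n] q_fact_neq_0[of n] by (simp add: q_fact_def)

lemma q_binomial_eq_0 [simp]: "n < k \<Longrightarrow> q_binomial n k = 0"
  by (simp add: q_binomial_def)

lemma q_binomial_self [simp]: "q_binomial n n = 1"
  using q_binomial_exact[of n n] q_fact_neq_0[of n] by (simp add: q_fact_def)

text \<open>Since \<open>q_binomial\<close> is defined by an exact division, both sides are
  multiplied by the nonzero product \<open>?F\<close>. What remains is the splitting of
  \<open>q_int (Suc n)\<close> by \<open>q_int_add\<close>.\<close>

lemma q_binomial_Pascal:
  "q_binomial (Suc n) (Suc k) = q_binomial n k + monom 1 (Suc k) * q_binomial n (Suc k)"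
proof (cases "k < n")
  case True
  then obtain p where n: "n = Suc (k + p)" by (auto dest: less_imp_Suc_add)
  let ?F = "q_fact (Suc k) * q_fact (Suc p)"
  have "q_binomial n k * ?F = q_int (Suc k) * (q_binomial n k * (q_fact k * q_fact (Suc p)))"
    by (simp add: q_fact_Suc ac_simps)
  also have "\<dots> = q_int (Suc k) * q_fact n" using q_binomial_exact[of k n] n by simp
  finally have 1: "q_binomial n k * ?F = q_int (Suc k) * q_fact n" .
  have "q_binomial n (Suc k) * ?F
      = q_int (Suc p) * (q_binomial n (Suc k) * (q_fact (Suc k) * q_fact p))"
    by (simp add: q_fact_Suc ac_simps)
  also have "\<dots> = q_int (Suc p) * q_fact n" using q_binomial_exact[of "Suc k" n] n by simp
  finally have 2: "q_binomial n (Suc k) * ?F = q_int (Suc p) * q_fact n" .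
  have "(q_binomial n k + monom 1 (Suc k) * q_binomial n (Suc k)) * ?F
      = q_binomial n k * ?F + monom 1 (Suc k) * (q_binomial n (Suc k) * ?F)"
    by (simp only: algebra_simps)
  also have "\<dots> = q_fact n * q_int (Suc k + Suc p)"
    unfolding 1 2 q_int_add by (simp only: algebra_simps)
  also have "\<dots> = q_fact (Suc n)" by (simp add: q_fact_Suc n)
  also have "\<dots> = q_binomial (Suc n) (Suc k) * ?F"
    using q_binomial_exact[of "Suc k" "Suc n"] n by simp
  finally have "(q_binomial n k + monom 1 (Suc k) * q_binomial n (Suc k)) * ?F
      = q_binomial (Suc n) (Suc k) * ?F" .
  moreover have "?F \<noteq> 0" using q_fact_neq_0 by simp
  ultimately show ?thesis by (metis mult_right_cancel)
next
  case False
  then show ?thesis by (cases "k = n") simp_all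
qed

lemma primitive_root_of_unity_power_eq_1_iff:
  assumes "primitive_root_of_unity n z"
  shows "z ^ k = 1 \<longleftrightarrow> n dvd k"
proof -
  have n: "0 < n" "z ^ n = 1" "\<And>k. 0 < k \<Longrightarrow> k < n \<Longrightarrow> z ^ k \<noteq> 1"
    using assms by (auto simp: primitive_root_of_unity_def)
  have "z ^ k = z ^ (n * (k div n) + k mod n)" by simp
  also have "\<dots> = z ^ (k mod n)" using n(2) by (simp only: power_add power_mult) simp
  finally have "z ^ k = 1 \<longleftrightarrow> z ^ (k mod n) = 1" by simp
  also have "\<dots> \<longleftrightarrow> k mod n = 0" using n(3)[of "k mod n"] n(1) by auto
  finally show ?thesis by (simp add: dvd_eq_mod_eq_0)
qed

text \<open>At a primitive \<open>d\<close>-th root of unity \<open>q_int d\<close> vanishes and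
  \<open>q_int i\<close> does not for \<open>0 < i < d\<close>. Thus \<open>q_fact d\<close>
  vanishes while the two factorials in the denominator survive.\<close>

lemma q_binomial_root_of_unity_top:
  assumes "primitive_root_of_unity d w" and "0 < k" and "k < d"
  shows "q_eval (q_binomial d k) w = 0"
proof -
  have nz: "q_eval (q_fact j) w \<noteq> 0" if "j < d" for j
  proof -
    have "q_eval (q_int i) w \<noteq> 0" if i: "i \<in> {1..j}" for i
    proof
      assume 0: "q_eval (q_int i) w = 0"
      then have "w ^ i = 1"
        using power_diff_1_eq[of w i] by (auto simp: q_eval_q_int)
      then have "d dvd i" using primitive_root_of_unity_power_eq_1_iff[OF assms(1)] by simp
      then show False using i \<open>j < d\<close> by (auto dest: dvd_imp_le)
    qed
    then show ?thesis by (simp add: q_fact_def)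
  qed
  have "w ^ d = 1" "w \<noteq> 1"
    using primitive_root_of_unity_power_eq_1_iff[OF assms(1), of d]
      primitive_root_of_unity_power_eq_1_iff[OF assms(1), of 1] assms by auto
  then have "q_eval (q_int d) w = 0" by (simp add: q_eval_q_int_root_of_unity)
  then have "q_eval (q_fact d) w = 0"
    using assms by (auto simp: q_fact_def intro!: bexI[of _ d])
  moreover have "q_eval (q_binomial d k) w * (q_eval (q_fact k) w * q_eval (q_fact (d - k)) w)
      = q_eval (q_fact d) w"
    using arg_cong[OF q_binomial_exact[of k d], of "\<lambda>f. q_eval f w"] assms by simp
  ultimately show ?thesis using nz[of k] nz[of "d - k"] assms by auto
qed

text \<open>In row \<open>d\<close> only the two outer coefficients survive, which is the case
  \<open>n = 0\<close>. The Pascal rule carries this to larger \<open>n\<close>, because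
  \<open>w ^ d = 1\<close> gives the entries at \<open>k\<close> and \<open>k - d\<close> the same
  weight.\<close>

lemma q_binomial_root_of_unity_add:
  assumes w: "primitive_root_of_unity d w"
  shows "q_eval (q_binomial (n + d) k) w = q_eval (q_binomial n k) w
    + (if d \<le> k then q_eval (q_binomial n (k - d)) w else 0)"
proof (induction n arbitrary: k)
  case 0
  have d: "0 < d" using w by (simp add: primitive_root_of_unity_def)
  consider "k = 0" | "0 < k" "k < d" | "k = d" | "d < k" by linarith
  then show ?case
  proof cases
    case 2
    then show ?thesis using q_binomial_root_of_unity_top[OF w] by simp
  qed (use d in simp_all)
next
  case (Suc n)
  have d: "0 < d" "w ^ d = 1" using w by (simp_all add: primitive_root_of_unity_def)
  show ?case
  proof (cases k)
    case 0
    then show ?thesis using d by simp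
  next
    case k: (Suc l)
    have L: "q_eval (q_binomial (Suc n + d) k) w = q_eval (q_binomial (n + d) l) w
        + w ^ Suc l * q_eval (q_binomial (n + d) (Suc l)) w"
      using k by (simp add: q_binomial_Pascal)
    show ?thesis
    proof (cases "d \<le> l")
      case True
      then obtain j where l: "l = d + j" using le_Suc_ex by blast
      show ?thesis
        unfolding L Suc.IH using k l d
        by (simp add: q_binomial_Pascal Suc_diff_le power_add algebra_simps)
    next
      case False
      \<comment> \<open>At \<open>d = Suc l\<close> the new summand is \<open>w ^ d\<close> times
        the entry with lower index 0, hence 1, which is also the entry with lower index 0 in the
        next row.\<close>
      then show ?thesis
        unfolding L Suc.IH using k d
        by (cases "d = Suc l") (auto simp: q_binomial_Pascal algebra_simps simp flip: power_Suc)
    qed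
  qed
qed

text \<open>Adding a block of \<open>d\<close> turns the previous recurrence into the ordinary
  Pascal rule for \<open>n\<close> and \<open>k div d\<close>.\<close>

lemma q_binomial_root_of_unity:
  assumes w: "primitive_root_of_unity d w"
  shows "q_eval (q_binomial (d * n) k) w = (if d dvd k then of_nat (n choose (k div d)) else 0)"
proof (induction n arbitrary: k)
  case 0
  show ?case
  proof (cases "k = 0")
    case False
    then have "d dvd k \<Longrightarrow> 0 < k div d"
      using w by (auto simp: primitive_root_of_unity_def elim: dvdE)
    then show ?thesis using False by (auto simp: binomial_eq_0)
  qed simp
next
  case (Suc n)
  have d: "0 < d" using w by (simp add: primitive_root_of_unity_def)
  have eq: "d * Suc n = d * n + d" by simp
  show ?case
  proof (cases "d \<le> k")
    case True
    then obtain j where k: "k = j + d" by (metis le_add_diff_inverse2)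
    show ?thesis unfolding eq q_binomial_root_of_unity_add[OF w] Suc.IH
      using d by (simp add: k add.commute)
  next
    case False
    then have "k div d = 0" "d dvd k \<longleftrightarrow> k = 0" by (auto dest: dvd_imp_le)
    then show ?thesis unfolding eq q_binomial_root_of_unity_add[OF w] Suc.IH
      using False by simp
  qed
qed

section \<open>Periodic words\<close>

definition shift :: "int \<Rightarrow> (int \<Rightarrow> bool) \<Rightarrow> int \<Rightarrow> bool" where
  "shift k f = (\<lambda>x. f (x + k))"

lemma shift_0 [simp]: "shift 0 f = f"
  by (simp add: shift_def)

lemma shift_shift [simp]: "shift j (shift k f) = shift (j + k) f"
  by (simp add: shift_def algebra_simps)

lemma shift_uminus_eq_iff: "shift (- k) f = f \<longleftrightarrow> shift k f = f"
proof -
  have "shift k (shift (- k) f) = f" "shift (- k) (shift k f) = f" by simp_all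
  then show ?thesis by metis
qed

lemma shift_period_add: "shift j f = f \<Longrightarrow> shift (k + j) f = shift k f"
  by (metis shift_shift)

lemma shift_period_mult: "shift k f = f \<Longrightarrow> shift (k * j) f = f"
proof -
  assume k: "shift k f = f"
  have nat: "shift (k * int n) f = f" for n
  proof (induction n)
    case (Suc n)
    then show ?case using k shift_shift[of k "k * int n" f] by (simp add: algebra_simps)
  qed simp
  show ?thesis
  proof (cases "0 \<le> j")
    case True
    then show ?thesis using nat[of "nat j"] by simp
  next
    case False
    then show ?thesis using nat[of "nat (- j)"] shift_uminus_eq_iff[of "k * j" f] by simp
  qed
qed

lemma shift_period_dvd: "shift k f = f \<Longrightarrow> k dvd l \<Longrightarrow> shift l f = f"
  by (auto elim: dvdE simp: shift_period_mult)

text \<open>The periods of a word form a subgroup of the integers, so Bezout coefficients combine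
  two periods into their gcd.\<close>

lemma shift_period_gcd:
  "shift (gcd k l) f = f \<longleftrightarrow> shift k f = f \<and> shift l f = f"
proof
  assume kl: "shift k f = f \<and> shift l f = f"
  obtain u v where "u * k + v * l = gcd k l" using bezout_int by blast
  moreover have "shift (k * u + l * v) f = f"
    using kl by (metis shift_period_mult shift_shift)
  ultimately show "shift (gcd k l) f = f" by (simp add: mult.commute)
qed (auto intro: shift_period_dvd)

lemma shift_period_mod: "shift g f = f \<Longrightarrow> f (x mod g) = f x"
proof -
  assume "shift g f = f"
  then have "shift (g * (x div g)) f = f" by (rule shift_period_mult)
  then have "f (x mod g + g * (x div g)) = f (x mod g)" unfolding shift_def by metis
  then show ?thesis by simp
qed

lemma card_periodic_window:
  assumes "shift (int g) f = f"
  shows "card {x \<in> {0..<int (d * g)}. f x} = d * card {x \<in> {0..<int g}. f x}"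
proof (induction d)
  case (Suc d)
  have "{x \<in> {0..<int (Suc d * g)}. f x}
      = {x \<in> {0..<int (d * g)}. f x} \<union> {x \<in> {int (d * g)..<int (Suc d * g)}. f x}"
    by (auto intro: order_trans[of 0 "int (d * g)"] simp del: of_nat_mult)
  moreover have "{x \<in> {int (d * g)..<int (Suc d * g)}. f x}
      = (\<lambda>x. x + int (d * g)) ` {x \<in> {0..<int g}. f x}"
  proof -
    have sh: "f (x + int (d * g)) = f x" for x
      using shift_period_mult[OF assms, of "int d"] unfolding shift_def
      by (metis mult.commute of_nat_mult)
    show ?thesis
    proof (intro set_eqI iffI)
      fix x assume x: "x \<in> {x \<in> {int (d * g)..<int (Suc d * g)}. f x}"
      then have "x - int (d * g) \<in> {x \<in> {0..<int g}. f x}"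
        using sh[of "x - int (d * g)"] by (auto simp: algebra_simps)
      then show "x \<in> (\<lambda>x. x + int (d * g)) ` {x \<in> {0..<int g}. f x}"
        by (rule rev_image_eqI) simp
    qed (use sh in \<open>auto simp: algebra_simps\<close>)
  qed
  moreover have "card ((\<lambda>x. x + int (d * g)) ` {x \<in> {0..<int g}. f x})
      = card {x \<in> {0..<int g}. f x}"
    by (rule card_image) (simp add: inj_on_def)
  moreover have "card ({x \<in> {0..<int (d * g)}. f x} \<union> {x \<in> {int (d * g)..<int (Suc d * g)}. f x})
      = card {x \<in> {0..<int (d * g)}. f x} + card {x \<in> {int (d * g)..<int (Suc d * g)}. f x}"
    by (intro card_Un_disjoint finite_Collect_conjI disjI1) auto
  ultimately show ?case using Suc by simp
qed simp

text \<open>A word of period \<open>g\<close> amounts to an arbitrary subset of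
  \<open>{0..<g}\<close>. A window of \<open>d\<close> periods repeats this subset \<open>d\<close>
  times, so its weight \<open>b\<close> must be \<open>d\<close> times the size of the
  subset.\<close>

lemma card_periodic_words:
  assumes "0 < g" and "0 < d"
  shows "finite {f. shift (int g) f = f \<and> card {x \<in> {0..<int (d * g)}. f x} = b}" (is "finite ?F")
    and "card {f. shift (int g) f = f \<and> card {x \<in> {0..<int (d * g)}. f x} = b}
      = (if d dvd b then g choose (b div d) else 0)"
proof -
  let ?B = "{A. A \<subseteq> {0..<int g} \<and> d * card A = b}"
  have bij: "bij_betw (\<lambda>f. {x \<in> {0..<int g}. f x}) ?F ?B"
  proof (rule bij_betw_byWitness[where f' = "\<lambda>A x. x mod int g \<in> A"])
    show "\<forall>f\<in>?F. (\<lambda>x. x mod int g \<in> {x \<in> {0..<int g}. f x}) = f"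
      using assms by (auto simp: shift_period_mod)
    show "\<forall>A\<in>?B. {x \<in> {0..<int g}. x mod int g \<in> A} = A"
      by auto
    show "(\<lambda>f. {x \<in> {0..<int g}. f x}) ` ?F \<subseteq> ?B"
      using card_periodic_window by auto
    show "(\<lambda>A x. x mod int g \<in> A) ` ?B \<subseteq> ?F"
    proof safe
      fix A assume A: "A \<subseteq> {0..<int g}"
      show p: "shift (int g) (\<lambda>x. x mod int g \<in> A) = (\<lambda>x. x mod int g \<in> A)"
        by (simp add: shift_def)
      have "{x \<in> {0..<int g}. x mod int g \<in> A} = A" using A by auto
      then show "card {x \<in> {0..<int (d * g)}. x mod int g \<in> A} = d * card A"
        using card_periodic_window[OF p, of d] by simp
    qed
  qed
  moreover have "finite ?B" by (rule finite_subset[of _ "Pow {0..<int g}"]) auto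
  moreover have "card ?B = (if d dvd b then g choose (b div d) else 0)"
  proof (cases "d dvd b")
    case True
    then have "?B = {A. A \<subseteq> {0..<int g} \<and> card A = b div d}"
      using assms by auto
    then show ?thesis using True n_subsets[of "{0..<int g}" "b div d"] by simp
  next
    case False
    then show ?thesis by auto
  qed
  ultimately show "finite ?F" "card ?F = (if d dvd b then g choose (b div d) else 0)"
    using bij_betw_finite[OF bij] bij_betw_same_card[OF bij] by simp_all
qed

definition words :: "nat \<Rightarrow> nat \<Rightarrow> (int \<Rightarrow> bool) set" where
  "words m b = {f. shift (int m) f = f \<and> card {x \<in> {0..<int m}. f x} = b}"

lemma finite_words: "0 < m \<Longrightarrow> finite (words m b)"
  using card_periodic_words(1)[of m 1 b] by (simp add: words_def)

lemma card_words: "0 < m \<Longrightarrow> card (words m b) = m choose b"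
  using card_periodic_words(2)[of m 1 b] by (simp add: words_def)

text \<open>Having both periods \<open>m\<close> and \<open>n\<close> means having period
  \<open>gcd m n\<close>; \<open>d\<close> is the number of such periods in a window of length
  \<open>m\<close>.\<close>

lemma card_words_fixed:
  assumes m: "m = d * gcd m n" and "0 < m"
  shows "card {f \<in> words m b. shift (int n) f = f}
    = (if d dvd b then gcd m n choose (b div d) else 0)"
proof -
  have "{f \<in> words m b. shift (int n) f = f}
      = {f. shift (int (gcd m n)) f = f \<and> card {x \<in> {0..<int (d * gcd m n)}. f x} = b}"
    unfolding m[symmetric] by (auto simp: words_def shift_period_gcd simp flip: gcd_int_int_eq)
  moreover have "0 < gcd m n" "0 < d" using assms by (auto intro: gr0I)
  ultimately show ?thesis using card_periodic_words(2) by simp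
qed

text \<open>Adding \<open>k\<close> modulo \<open>m\<close> permutes the window and matches the
  positions of the rotated word with those of the original, so the weight is preserved.\<close>

lemma shift_in_words:
  assumes "f \<in> words m b" and "0 < m"
  shows "shift k f \<in> words m b"
proof -
  have f: "shift (int m) f = f" "card {x \<in> {0..<int m}. f x} = b"
    using assms by (auto simp: words_def)
  have p: "shift (int m) (shift k f) = shift k f"
    using f(1) by (simp add: add.commute shift_period_add)
  have "bij_betw (\<lambda>x. (x + k) mod int m) {x \<in> {0..<int m}. shift k f x} {x \<in> {0..<int m}. f x}"
  proof (rule bij_betw_byWitness[where f' = "\<lambda>x. (x - k) mod int m"])
    show "\<forall>x\<in>{x \<in> {0..<int m}. shift k f x}. ((x + k) mod int m - k) mod int m = x"
      by (auto simp: mod_diff_left_eq)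
    show "\<forall>x\<in>{x \<in> {0..<int m}. f x}. ((x - k) mod int m + k) mod int m = x"
      by (auto simp: mod_add_left_eq)
    show "(\<lambda>x. (x + k) mod int m) ` {x \<in> {0..<int m}. shift k f x} \<subseteq> {x \<in> {0..<int m}. f x}"
      using assms(2) shift_period_mod[OF f(1)] by (auto simp: shift_def)
    show "(\<lambda>x. (x - k) mod int m) ` {x \<in> {0..<int m}. f x} \<subseteq> {x \<in> {0..<int m}. shift k f x}"
    proof safe
      fix x assume "f x"
      then show "shift k f ((x - k) mod int m)"
        using shift_period_mod[OF p, of "x - k"] by (simp add: shift_def)
    qed (use assms(2) in auto)
  qed
  from bij_betw_same_card[OF this]
  have "card {x \<in> {0..<int m}. shift k f x} = b" using f(2) by simp
  then show ?thesis using p by (simp add: words_def)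
qed

text \<open>The cyclic interval of length \<open>b\<close> starting at residue \<open>-k\<close>.
  For \<open>k = 0\<close> it is the word of the missing set \<open>{1..b}\<close>.\<close>

definition arc :: "nat \<Rightarrow> nat \<Rightarrow> int \<Rightarrow> int \<Rightarrow> bool" where
  "arc m b k = shift k (\<lambda>x. x mod int m < int b)"

lemma shift_arc [simp]: "shift j (arc m b k) = arc m b (j + k)"
  by (simp add: arc_def)

lemma arc_in_words:
  assumes "b \<le> m" and "0 < m"
  shows "arc m b k \<in> words m b"
proof -
  have "{x \<in> {0..<int m}. x mod int m < int b} = {0..<int b}" using assms(1) by auto
  then have "(\<lambda>x. x mod int m < int b) \<in> words m b"
    by (simp add: words_def shift_def)
  then show ?thesis using assms(2) by (simp add: arc_def shift_in_words)
qed

text \<open>For \<open>0 < b < m\<close> a cyclic interval has a unique first element: it contains 0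
  but not -1, say. A rotation by \<open>r\<close> that preserves it keeps \<open>r\<close> inside
  and \<open>r - 1\<close> outside, which forces \<open>r = 0\<close> modulo
  \<open>m\<close>.\<close>

lemma arc_eq_iff:
  assumes "0 < b" and "b < m"
  shows "arc m b i = arc m b j \<longleftrightarrow> int m dvd i - j"
proof
  let ?f = "\<lambda>x. x mod int m < int b"
  assume "arc m b i = arc m b j"
  then have "shift (- j) (arc m b i) = shift (- j) (arc m b j)" by simp
  then have "shift (i - j) ?f = ?f" by (simp add: arc_def algebra_simps)
  then have eq: "(x + (i - j)) mod int m < int b \<longleftrightarrow> x mod int m < int b" for x
    unfolding shift_def by metis
  define r where "r = (i - j) mod int m"
  have r: "0 \<le> r" "r < int m" using assms by (simp_all add: r_def)
  have "r < int b" using eq[of 0] assms by (simp add: r_def)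
  moreover have "\<not> (r - 1) mod int m < int b"
  proof -
    have "(- 1) mod int m = int m - 1" using assms by (simp add: zmod_minus1)
    then have "\<not> (- 1 + (i - j)) mod int m < int b" using eq[of "- 1"] assms by simp
    moreover have "(- 1 + (i - j)) mod int m = (r - 1) mod int m"
      by (simp add: r_def mod_diff_left_eq)
    ultimately show ?thesis by simp
  qed
  ultimately have "r = 0" using r by (cases "r = 0") auto
  then show "int m dvd i - j" by (simp add: r_def dvd_eq_mod_eq_0)
next
  assume d: "int m dvd i - j"
  have "shift (int m) (arc m b j) = arc m b j"
    using arc_in_words[of b m j] assms by (simp add: words_def)
  then have "shift (i - j) (arc m b j) = arc m b j" using d by (rule shift_period_dvd)
  then show "arc m b i = arc m b j" by simp
qed

section \<open>Arcs and the rotation that skips one of them\<close>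

definition arcs :: "nat \<Rightarrow> nat \<Rightarrow> (int \<Rightarrow> bool) set" where
  "arcs m b = range (arc m b)"

lemma arcs_eq:
  assumes "0 < b" and "b < m"
  shows "arcs m b = arc m b ` {0..<int m}"
proof -
  have "arc m b k = arc m b (k mod int m)" for k
    using arc_eq_iff[OF assms, of k "k mod int m"] by (simp add: dvd_minus_mod)
  moreover have "k mod int m \<in> {0..<int m}" for k using assms by simp
  ultimately have "arc m b k \<in> arc m b ` {0..<int m}" for k by (metis imageI)
  then show ?thesis by (auto simp: arcs_def)
qed

lemma card_arcs:
  assumes "0 < b" and "b < m"
  shows "card (arcs m b) = m" and "finite (arcs m b)"
proof -
  have "inj_on (arc m b) {0..<int m}"
  proof (rule inj_onI)
    fix i j assume ij: "i \<in> {0..<int m}" "j \<in> {0..<int m}" "arc m b i = arc m b j"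
    then have "int m dvd i - j" using arc_eq_iff[OF assms] by blast
    then have "i mod int m = j mod int m" unfolding mod_eq_dvd_iff .
    then show "i = j" using ij by simp
  qed
  then show "card (arcs m b) = m" by (simp add: arcs_eq[OF assms] card_image)
  show "finite (arcs m b)" by (simp add: arcs_eq[OF assms])
qed

lemma arcs_subset_words: "b \<le> m \<Longrightarrow> 0 < m \<Longrightarrow> arcs m b \<subseteq> words m b"
  by (auto simp: arcs_def arc_in_words)

lemma shift_in_arcs_iff [simp]: "shift k f \<in> arcs m b \<longleftrightarrow> f \<in> arcs m b"
proof
  assume "shift k f \<in> arcs m b"
  then obtain i where "shift k f = arc m b i" by (auto simp: arcs_def)
  then have "shift (- k) (shift k f) = shift (- k) (arc m b i)" by simp
  then have "f = arc m b (- k + i)" by simp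
  then show "f \<in> arcs m b" by (auto simp: arcs_def)
qed (auto simp: arcs_def)

text \<open>In the exceptional case the value is \<open>f\<close> rotated twice, so a single step
  passes over \<open>arc m b 0\<close>.\<close>

definition skip_shift :: "nat \<Rightarrow> nat \<Rightarrow> (int \<Rightarrow> bool) \<Rightarrow> int \<Rightarrow> bool" where
  "skip_shift m b f = (if shift 1 f = arc m b 0 then shift 1 (arc m b 0) else shift 1 f)"

text \<open>Being an arc is invariant under rotation, so the exceptional case never arises along
  this trajectory.\<close>

lemma skip_shift_funpow_not_arc:
  assumes "f \<notin> arcs m b"
  shows "(skip_shift m b ^^ n) f = shift (int n) f"
proof (induction n)
  case (Suc n)
  have "shift 1 (shift (int n) f) \<noteq> arc m b 0"
    using assms shift_in_arcs_iff[of "1 + int n" f m b] by (auto simp: arcs_def)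
  then show ?case using Suc by (simp add: skip_shift_def)
qed simp

text \<open>Adding 1 after reduction modulo \<open>m - 1\<close> leaves out the skipped arc \<open>arc m b 0\<close>.\<close>

definition skip_arc :: "nat \<Rightarrow> nat \<Rightarrow> nat \<Rightarrow> int \<Rightarrow> bool" where
  "skip_arc m b k = arc m b (int (k mod (m - 1)) + 1)"

text \<open>Rotation leads to index \<open>r + 2\<close>, which is at most \<open>m\<close>. It
  reaches the skipped arc exactly when \<open>r\<close> is the last residue modulo
  \<open>m - 1\<close>, and the extra rotation to index 1 is then the wrap-around to residue
  0.\<close>

lemma skip_shift_skip_arc:
  assumes "0 < b" and "b < m"
  shows "skip_shift m b (skip_arc m b k) = skip_arc m b (Suc k)"
proof -
  define r where "r = k mod (m - 1)"
  have r: "r < m - 1" using assms by (simp add: r_def)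
  have arc0: "arc m b (2 + int r) = arc m b 0 \<longleftrightarrow> int m dvd 2 + int r"
    using arc_eq_iff[OF assms, of "2 + int r" 0] by simp
  show ?thesis
  proof (cases "Suc r = m - 1")
    case True
    then have "Suc k mod (m - 1) = 0" by (simp add: mod_Suc r_def)
    moreover have "2 + int r = int m" using True by simp
    ultimately show ?thesis using arc0
      by (simp add: skip_shift_def skip_arc_def r_def[symmetric] del: One_nat_def)
  next
    case False
    then have "Suc k mod (m - 1) = Suc r" by (simp add: mod_Suc r_def)
    moreover have "\<not> int m dvd 2 + int r"
      using r False by (auto dest!: zdvd_imp_le)
    ultimately show ?thesis using arc0
      by (simp add: skip_shift_def skip_arc_def r_def[symmetric] del: One_nat_def)
  qed
qed

lemma skip_shift_funpow_skip_arc: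
  assumes "0 < b" and "b < m"
  shows "(skip_shift m b ^^ n) (skip_arc m b k) = skip_arc m b (k + n)"
  by (induction n) (simp_all add: skip_shift_skip_arc[OF assms])

lemma skip_arc_eq_iff:
  assumes "0 < b" and "b < m"
  shows "skip_arc m b k = skip_arc m b l \<longleftrightarrow> k mod (m - 1) = l mod (m - 1)"
proof
  define r s where "r = k mod (m - 1)" and "s = l mod (m - 1)"
  have rs: "r < m - 1" "s < m - 1" using assms by (simp_all add: r_def s_def)
  assume "skip_arc m b k = skip_arc m b l"
  then have "int m dvd int r - int s"
    using arc_eq_iff[OF assms] by (simp add: skip_arc_def r_def s_def)
  then have "int r mod int m = int s mod int m" unfolding mod_eq_dvd_iff .
  then have "r = s" using rs by simp
  then show "k mod (m - 1) = l mod (m - 1)" by (simp only: r_def s_def)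
qed (simp add: skip_arc_def)

text \<open>Together with the two preceding facts on \<open>skip_arc\<close>, this identifies the
  remaining arcs as one cycle of length \<open>m - 1\<close>.\<close>

lemma arcs_minus_eq_range_skip_arc:
  assumes "0 < b" and "b < m"
  shows "arcs m b - {arc m b 0} = range (skip_arc m b)"
proof (intro set_eqI iffI)
  fix f assume f: "f \<in> arcs m b - {arc m b 0}"
  then obtain i where i: "f = arc m b i" "i \<in> {0..<int m}" by (auto simp: arcs_eq[OF assms])
  with f have "i \<noteq> 0" by auto
  with i have "f = skip_arc m b (nat (i - 1))" by (simp add: skip_arc_def nat_less_iff)
  then show "f \<in> range (skip_arc m b)" by simp
next
  fix f assume "f \<in> range (skip_arc m b)"
  then obtain k where f: "f = skip_arc m b k" by auto
  define r where "r = k mod (m - 1)"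
  have r: "r < m - 1" using assms by (simp add: r_def)
  have "\<not> int m dvd int r + 1" using r by (auto dest!: zdvd_imp_le)
  then have "f \<noteq> arc m b 0"
    using arc_eq_iff[OF assms, of "int r + 1" 0] by (simp add: f skip_arc_def r_def)
  then show "f \<in> arcs m b - {arc m b 0}" by (simp add: f skip_arc_def arcs_def)
qed

lemma skip_shift_funpow_fixed_iff:
  assumes "0 < b" and "b < m" and "f \<noteq> arc m b 0"
  shows "(skip_shift m b ^^ n) f = f \<longleftrightarrow>
    (if f \<in> arcs m b then (m - 1) dvd n else shift (int n) f = f)"
proof (cases "f \<in> arcs m b")
  case True
  then obtain k where f: "f = skip_arc m b k"
    using assms(3) arcs_minus_eq_range_skip_arc[OF assms(1,2)] by blast
  have "(skip_shift m b ^^ n) f = f \<longleftrightarrow> (k + n) mod (m - 1) = k mod (m - 1)"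
    unfolding f skip_shift_funpow_skip_arc[OF assms(1,2)] skip_arc_eq_iff[OF assms(1,2)] ..
  also have "\<dots> \<longleftrightarrow> (m - 1) dvd n"
    using mod_eq_dvd_iff_nat[of k "k + n" "m - 1"] by simp
  finally show ?thesis using True by simp
next
  case False
  then show ?thesis by (simp add: skip_shift_funpow_not_arc)
qed

text \<open>Words that are not arcs contribute equally to both counts. The arcs contribute all
  \<open>m - 1\<close> or none to the skipping rotation, and all \<open>m\<close> or none to plain
  rotation. The additive form avoids truncated subtraction.\<close>

lemma card_skip_shift_fixed:
  assumes "0 < b" and "b < m"
  shows "card {f \<in> words m b - {arc m b 0}. (skip_shift m b ^^ n) f = f}
      + (if m dvd n then m else 0)
    = (if (m - 1) dvd n then m - 1 else 0) + card {f \<in> words m b. shift (int n) f = f}"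
proof -
  let ?A = "if (m - 1) dvd n then arcs m b - {arc m b 0} else {}"
  let ?N = "{f \<in> words m b - arcs m b. shift (int n) f = f}"
  let ?C = "{f \<in> arcs m b. shift (int n) f = f}"
  have fin: "finite (words m b)" using finite_words assms by simp
  have sub: "arcs m b \<subseteq> words m b" using arcs_subset_words assms by simp
  have arc0: "arc m b 0 \<in> arcs m b" by (simp add: arcs_def)
  have "{f \<in> words m b - {arc m b 0}. (skip_shift m b ^^ n) f = f} = ?A \<union> ?N"
    using sub arc0
    by (auto simp: skip_shift_funpow_fixed_iff[OF assms] skip_shift_funpow_not_arc split: if_splits)
  moreover have "card (?A \<union> ?N) = card ?A + card ?N"
    using fin sub card_arcs[OF assms] by (intro card_Un_disjoint) auto
  moreover have "card ?A = (if (m - 1) dvd n then m - 1 else 0)"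
    using card_arcs[OF assms] arc0 by (simp add: card_Diff_singleton)
  moreover have "{f \<in> words m b. shift (int n) f = f} = ?N \<union> ?C" using sub by auto
  moreover have "card (?N \<union> ?C) = card ?N + card ?C"
    using fin card_arcs[OF assms] by (intro card_Un_disjoint) auto
  moreover have "card ?C = (if m dvd n then m else 0)"
  proof -
    have "shift (int n) f = f \<longleftrightarrow> m dvd n" if f: "f \<in> arcs m b" for f
      using f arc_eq_iff[OF assms] by (auto simp: arcs_def)
    then have "?C = {f \<in> arcs m b. m dvd n}" by auto
    then show ?thesis using card_arcs[OF assms] by auto
  qed
  ultimately show ?thesis by simp
qed

section \<open>Tableaux of ribbon shape\<close>

text \<open>Provides the entries of a row that begins in column \<open>a\<close>, given the set of
  these entries.\<close>

lemma strict_mono_on_enumeration: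
  fixes B :: "nat set"
  assumes "finite B"
  obtains e where "strict_mono_on {a..<a + card B} e" and "e ` {a..<a + card B} = B"
proof
  let ?e = "\<lambda>i. sorted_list_of_set B ! (i - a)"
  show "strict_mono_on {a..<a + card B} ?e"
    by (rule strict_mono_onI)
      (auto intro!: sorted_wrt_nth_less[of "(<)"] simp: assms)
  have "?e ` {a..<a + card B} = (!) (sorted_list_of_set B) ` {0..<card B}"
  proof (intro set_eqI iffI)
    fix y assume "y \<in> (!) (sorted_list_of_set B) ` {0..<card B}"
    then obtain i where "i < card B" "y = ?e (i + a)" by auto
    then show "y \<in> ?e ` {a..<a + card B}" by (intro image_eqI[of _ _ "i + a"]) auto
  qed auto
  also have "\<dots> = set (sorted_list_of_set B)"
    by (simp add: set_conv_nth) auto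
  finally show "?e ` {a..<a + card B} = B" using assms by simp
qed

text \<open>A row is recovered from its set of entries, because a strictly sorted list is determined
  by its set.\<close>

lemma strict_mono_on_image_unique:
  fixes f g :: "nat \<Rightarrow> nat"
  assumes "strict_mono_on {a..<c} f" and "strict_mono_on {a..<c} g"
    and "f ` {a..<c} = g ` {a..<c}" and "i \<in> {a..<c}"
  shows "f i = g i"
proof -
  have "sorted_wrt (<) (map h [a..<c])" if "strict_mono_on {a..<c} h" for h :: "nat \<Rightarrow> nat"
    using that unfolding sorted_wrt_map
    by (intro sorted_wrt_mono_rel[OF _ sorted_wrt_upt]) (auto simp: strict_mono_on_def)
  then have "map f [a..<c] = map g [a..<c]"
    using assms by (intro strict_sorted_equal) auto
  then show ?thesis using assms(4) by simp
qed

text \<open>The common shape of all promotions: the dot starts in \<open>c\<^sub>1\<close> and ends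
  in \<open>d\<close>, and \<open>\<tau>\<close> sends every other cell to the one its entry came
  from.\<close>

lemma bij_betw_decrement:
  fixes T :: "'a \<Rightarrow> nat"
  assumes T: "bij_betw T S {1..m}" and "c\<^sub>1 \<in> S" and "T c\<^sub>1 = 1" and "d \<in> S"
    and \<tau>: "bij_betw \<tau> (S - {d}) (S - {c\<^sub>1})"
  shows "bij_betw (\<lambda>c. if c = d then m else if c \<in> S then T (\<tau> c) - 1 else 0) S {1..m}"
proof -
  let ?U = "\<lambda>c. if c = d then m else if c \<in> S then T (\<tau> c) - 1 else 0"
  have m: "1 \<le> m" using assms bij_betwE[OF T] by auto
  have "bij_betw T (S - {c\<^sub>1}) ({1..m} - {1})"
    using bij_betw_DiffI[OF T, of "{c\<^sub>1}" "{1}"] assms m by (simp add: bij_betw_def)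
  then have "bij_betw (T \<circ> \<tau>) (S - {d}) ({1..m} - {1})" using \<tau> bij_betw_trans by blast
  moreover have "bij_betw (\<lambda>x. x - 1) ({1..m} - {1}) {1..m - 1}"
    by (rule bij_betw_byWitness[where f' = Suc]) auto
  ultimately have "bij_betw ((\<lambda>x. x - 1) \<circ> (T \<circ> \<tau>)) (S - {d}) {1..m - 1}"
    by (rule bij_betw_trans)
  then have "bij_betw ?U (S - {d}) {1..m - 1}"
    by (rule bij_betw_cong[THEN iffD1, rotated]) simp
  moreover have "bij_betw ?U {d} {m}" by (simp add: bij_betw_def)
  ultimately have "bij_betw ?U ((S - {d}) \<union> {d}) ({1..m - 1} \<union> {m})"
    by (rule bij_betw_combine) (use m in auto)
  moreover have "(S - {d}) \<union> {d} = S" "{1..m - 1} \<union> {m} = {1..m}" using assms m by auto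
  ultimately show ?thesis by simp
qed

section \<open>Slides along a row\<close>

lemma slide_stop:
  "right_of c \<notin> S \<Longrightarrow> below c \<notin> S \<Longrightarrow> slide S (c, T) = (c, T)"
  unfolding slide_def by (subst while_unfold) simp

lemma slide_unfold:
  "right_of c \<in> S \<or> below c \<in> S \<Longrightarrow>
    slide S (c, T) = slide S (slide_target S T c, T(c := T (slide_target S T c), slide_target S T c := T c))"
  unfolding slide_def by (subst while_unfold) (simp add: slide_step_def Let_def)

text \<open>The last hypothesis makes every comparison on the way favour the right neighbour; at
  column \<open>e\<close> neither neighbour exists and the dot stops.\<close>

lemma slide_row:
  assumes "j \<le> e" and "\<And>k. j \<le> k \<Longrightarrow> k \<le> e \<Longrightarrow> (i, k) \<in> S"
    and "(i, Suc e) \<notin> S" and "(Suc i, e) \<notin> S"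
    and "\<And>k. j \<le> k \<Longrightarrow> k < e \<Longrightarrow> (Suc i, k) \<in> S \<Longrightarrow> T (i, Suc k) < T (Suc i, k)"
  shows "slide S ((i, j), T) = ((i, e), \<lambda>c. if fst c = i \<and> j \<le> snd c \<and> snd c < e then T (right_of c)
    else if c = (i, e) then T (i, j) else T c)"
  using assms
proof (induction "e - j" arbitrary: j T)
  case 0
  then have "j = e" by simp
  then show ?case using 0
    by (subst slide_stop) (auto simp: right_of_def below_def fun_eq_iff)
next
  case (Suc n)
  let ?T = "T((i, j) := T (i, Suc j), (i, Suc j) := T (i, j))"
  have je: "j < e" using Suc by simp
  have "slide_target S T (i, j) = (i, Suc j)"
    using Suc.prems(2)[of "Suc j"] Suc.prems(5)[of j] je
    by (auto simp: slide_target_def right_of_def below_def)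
  moreover have "right_of (i, j) \<in> S"
    using Suc.prems(2)[of "Suc j"] je by (simp add: right_of_def)
  ultimately have "slide S ((i, j), T) = slide S ((i, Suc j), ?T)"
    by (subst slide_unfold) simp_all
  \<comment> \<open>The swap alters row \<open>i\<close> only in columns \<open>j\<close> and
    \<open>Suc j\<close>. Later comparisons read that row from column \<open>Suc (Suc j)\<close> on,
    so the hypotheses pass to the new filling.\<close>
  also have "\<dots> = ((i, e), \<lambda>c. if fst c = i \<and> Suc j \<le> snd c \<and> snd c < e then ?T (right_of c)
    else if c = (i, e) then ?T (i, Suc j) else ?T c)"
    using Suc.hyps(2) Suc.prems je by (intro Suc.hyps(1)) auto
  also have "\<dots> = ((i, e), \<lambda>c. if fst c = i \<and> j \<le> snd c \<and> snd c < e then T (right_of c)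
    else if c = (i, e) then T (i, j) else T c)"
    using je by (auto simp: fun_eq_iff right_of_def)
  finally show ?case .
qed

lemma promotion_eq:
  assumes "inj_on T S" and "c \<in> S" and "T c = 1" and "slide S (c, T) = (d, U)"
  shows "promotion S T = (\<lambda>c. if c = d then card S else if c \<in> S then U c - 1 else 0)"
proof -
  have "(THE c. c \<in> S \<and> T c = 1) = c"
    using assms(1-3) by (intro the_equality) (simp, metis inj_onD)
  then show ?thesis using assms(4) by (simp add: promotion_def)
qed

definition bottom_entries :: "nat \<Rightarrow> (cell \<Rightarrow> nat) \<Rightarrow> nat set" where
  "bottom_entries b T = (\<lambda>j. T (2, j)) ` {1..b}"

definition cyclic_pred :: "nat \<Rightarrow> nat \<Rightarrow> nat" where
  "cyclic_pred m x = (if x = 1 then m else x - 1)"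

section \<open>Promotion on the two-row ribbon\<close>

locale two_row_ribbon =
  fixes m b :: nat
  assumes b_pos: "1 \<le> b" and b_less: "b < m"
begin

abbreviation S :: "cell set" where
  "S \<equiv> ribbon (m - b) b"

lemma in_S_iff: "(i, j) \<in> S \<longleftrightarrow> i = 1 \<and> b \<le> j \<and> j < m \<or> i = 2 \<and> 1 \<le> j \<and> j \<le> b"
  using b_less by (auto simp: ribbon_def)

lemma S_eq: "S = Pair 1 ` {b..<m} \<union> Pair 2 ` {1..b}"
  by (auto simp: in_S_iff)

lemma finite_S: "finite S"
  by (simp add: S_eq)

lemma card_S: "card S = m"
proof -
  have "card S = card (Pair (1::nat) ` {b..<m}) + card (Pair (2::nat) ` {1..b})"
    unfolding S_eq by (rule card_Un_disjoint) auto
  then show ?thesis using b_less by (simp add: card_image inj_on_def)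
qed

text \<open>Column \<open>b\<close> is the only column with two cells, so the column condition is a
  single inequality.\<close>

lemma SYT_iff:
  "T \<in> SYT S \<longleftrightarrow> bij_betw T S {1..m} \<and> (\<forall>c. c \<notin> S \<longrightarrow> T c = 0) \<and>
    strict_mono_on {b..<m} (\<lambda>j. T (1, j)) \<and> strict_mono_on {1..b} (\<lambda>j. T (2, j)) \<and>
    T (1, b) < T (2, b)"
proof -
  have "(\<forall>i j j'. (i, j) \<in> S \<and> (i, j') \<in> S \<and> j < j' \<longrightarrow> T (i, j) < T (i, j')) \<longleftrightarrow>
      strict_mono_on {b..<m} (\<lambda>j. T (1, j)) \<and> strict_mono_on {1..b} (\<lambda>j. T (2, j))"
    unfolding strict_mono_on_def in_S_iff by auto
  moreover have "(\<forall>i i' j. (i, j) \<in> S \<and> (i', j) \<in> S \<and> i < i' \<longrightarrow> T (i, j) < T (i', j)) \<longleftrightarrow>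
      T (1, b) < T (2, b)"
  proof
    assume "\<forall>i i' j. (i, j) \<in> S \<and> (i', j) \<in> S \<and> i < i' \<longrightarrow> T (i, j) < T (i', j)"
    moreover have "(1, b) \<in> S" "(2, b) \<in> S" using b_pos b_less by (auto simp: in_S_iff)
    ultimately show "T (1, b) < T (2, b)" by force
  next
    assume "T (1, b) < T (2, b)"
    then show "\<forall>i i' j. (i, j) \<in> S \<and> (i', j) \<in> S \<and> i < i' \<longrightarrow> T (i, j) < T (i', j)"
      by (auto simp: in_S_iff dest!: le_antisym)
  qed
  ultimately show ?thesis by (simp add: SYT_def card_S conj_assoc)
qed

context
  fixes T assumes T: "T \<in> SYT S"
begin

lemma SYT_bij: "bij_betw T S {1..m}"
  and SYT_outside: "c \<notin> S \<Longrightarrow> T c = 0"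
  and SYT_top: "strict_mono_on {b..<m} (\<lambda>j. T (1, j))"
  and SYT_bottom: "strict_mono_on {1..b} (\<lambda>j. T (2, j))"
  and SYT_corner: "T (1, b) < T (2, b)"
  using T unfolding SYT_iff by blast+

lemma top_less: "b \<le> j \<Longrightarrow> j < k \<Longrightarrow> k < m \<Longrightarrow> T (1, j) < T (1, k)"
  using SYT_top by (auto simp: strict_mono_on_def)

lemma bottom_less: "1 \<le> j \<Longrightarrow> j < k \<Longrightarrow> k \<le> b \<Longrightarrow> T (2, j) < T (2, k)"
  using SYT_bottom by (auto simp: strict_mono_on_def)

lemma SYT_range: "c \<in> S \<Longrightarrow> 1 \<le> T c \<and> T c \<le> m"
  using bij_betwE[OF SYT_bij] by auto

lemma SYT_inj: "c \<in> S \<Longrightarrow> d \<in> S \<Longrightarrow> T c = T d \<longleftrightarrow> c = d"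
  using SYT_bij by (auto simp: bij_betw_def inj_on_def)

lemma bottom_entries_subset: "bottom_entries b T \<subseteq> {1..m}"
  using SYT_range by (auto simp: bottom_entries_def in_S_iff)

lemma card_bottom_entries: "card (bottom_entries b T) = b"
  using strict_mono_on_imp_inj_on[OF SYT_bottom] by (simp add: bottom_entries_def card_image)

lemma top_entries: "(\<lambda>j. T (1, j)) ` {b..<m} = {1..m} - bottom_entries b T"
proof -
  have "{1..m} = T ` S" using SYT_bij by (simp add: bij_betw_def)
  also have "\<dots> = (\<lambda>j. T (1, j)) ` {b..<m} \<union> bottom_entries b T"
    unfolding S_eq bottom_entries_def by (auto simp: image_Un image_image)
  moreover have "(\<lambda>j. T (1, j)) ` {b..<m} \<inter> bottom_entries b T = {}"
    by (auto simp: bottom_entries_def SYT_inj in_S_iff)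
  ultimately show ?thesis by auto
qed

text \<open>With the \<open>b\<close> smallest numbers in the bottom row every top entry would be
  larger than \<open>T (2, b)\<close>, against the corner inequality.\<close>

lemma bottom_entries_neq: "bottom_entries b T \<noteq> {1..b}"
proof
  assume eq: "bottom_entries b T = {1..b}"
  have "T (2, b) \<in> {1..b}" unfolding eq[symmetric] using b_pos by (auto simp: bottom_entries_def)
  moreover have "T (1, b) \<in> {1..m} - {1..b}"
    unfolding eq[symmetric] top_entries[symmetric] using b_less by auto
  ultimately show False using SYT_corner by auto
qed

text \<open>The minimum has no left neighbour, so it starts a row.\<close>

lemma one_cases: "T (2, 1) = 1 \<or> T (1, b) = 1"
proof -
  have "1 \<in> T ` S" using SYT_bij b_less by (auto simp: bij_betw_def)
  then obtain c where c: "c \<in> S" "T c = 1" by auto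
  obtain i j where ij: "c = (i, j)" by (cases c)
  show ?thesis
  proof (cases "i = 2")
    case True
    then show ?thesis using c ij bottom_less[of 1 j] SYT_range[of "(2, 1)"]
      by (cases "j = 1") (auto simp: in_S_iff)
  next
    case False
    then show ?thesis using c ij top_less[of b j] SYT_range[of "(1, b)"]
      by (cases "j = b") (auto simp: in_S_iff)
  qed
qed

lemma promotion_bottom:
  assumes "T (2, 1) = 1"
  shows "promotion S T = (\<lambda>c. if c = (2, b) then m else if c \<in> S
    then T (if fst c = 2 then right_of c else c) - 1 else 0)"
proof -
  have "slide S ((2, 1), T) = ((2, b), \<lambda>c. if fst c = 2 \<and> 1 \<le> snd c \<and> snd c < b then T (right_of c)
    else if c = (2, b) then T (2, 1) else T c)"
    using b_pos b_less by (intro slide_row) (auto simp: in_S_iff)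
  from promotion_eq[OF _ _ assms this] show ?thesis
    using SYT_bij b_pos by (auto simp: bij_betw_def in_S_iff card_S fun_eq_iff)
qed

text \<open>Beyond column \<open>b\<close> no cell of the top row has a lower neighbour, so the
  comparison at the corner alone decides that the dot runs along the whole row.\<close>

lemma promotion_top:
  assumes "T (1, b) = 1" and "Suc b < m" and "T (1, Suc b) < T (2, b)"
  shows "promotion S T = (\<lambda>c. if c = (1, m - 1) then m else if c \<in> S
    then T (if fst c = 1 then right_of c else c) - 1 else 0)"
proof -
  have "slide S ((1, b), T) = ((1, m - 1), \<lambda>c. if fst c = 1 \<and> b \<le> snd c \<and> snd c < m - 1 then T (right_of c)
    else if c = (1, m - 1) then T (1, b) else T c)"
    using assms b_less by (intro slide_row) (auto simp: in_S_iff numeral_2_eq_2 dest: le_antisym)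
  from promotion_eq[OF _ _ assms(1) this] show ?thesis
    using SYT_bij b_less by (auto simp: bij_betw_def in_S_iff card_S fun_eq_iff)
qed

text \<open>The right neighbour of the corner is absent or not smaller than the lower one, so the
  dot drops to \<open>(2, b)\<close>, the end of the bottom row, after one swap.\<close>

lemma promotion_corner:
  assumes "T (1, b) = 1" and "\<not> (Suc b < m \<and> T (1, Suc b) < T (2, b))"
  shows "promotion S T = (\<lambda>c. if c = (2, b) then m else if c \<in> S
    then T (if c = (1, b) then (2, b) else c) - 1 else 0)"
proof -
  have 2: "(2, b) \<in> S" using b_pos by (simp add: in_S_iff)
  have "slide_target S T (1, b) = (2, b)"
    using assms 2 by (auto simp: slide_target_def right_of_def below_def in_S_iff numeral_2_eq_2)
  then have "slide S ((1, b), T) = slide S ((2, b), T((1, b) := T (2, b), (2, b) := T (1, b)))"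
    using 2 by (subst slide_unfold) (auto simp: below_def numeral_2_eq_2)
  also have "\<dots> = ((2, b), T((1, b) := T (2, b), (2, b) := T (1, b)))"
    by (rule slide_stop) (auto simp: right_of_def below_def in_S_iff)
  finally have slide: "slide S ((1, b), T) = ((2, b), T((1, b) := T (2, b), (2, b) := T (1, b)))" .
  show ?thesis
    using promotion_eq[OF _ _ assms(1) slide] SYT_bij b_less
    by (auto simp: bij_betw_def in_S_iff card_S fun_eq_iff)
qed

lemma promotion_bottom_properties:
  assumes "T (2, 1) = 1"
  shows "promotion S T \<in> SYT S"
    and "bottom_entries b (promotion S T) = cyclic_pred m ` bottom_entries b T"
proof -
  let ?\<tau> = "\<lambda>c. if fst c = 2 then right_of c else c"
  note p = promotion_bottom[OF assms]
  have b2: "2 \<le> b"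
  proof (rule ccontr)
    assume "\<not> 2 \<le> b"
    then have "b = 1" using b_pos by simp
    then have "T (1, b) < 1" using SYT_corner assms by simp
    moreover have "(1, b) \<in> S" using b_less by (simp add: in_S_iff)
    ultimately show False using SYT_range[of "(1, b)"] by simp
  qed
  \<comment> \<open>Entries above 1 are what makes the truncated decrement strictly
    monotone.\<close>
  have gt1: "1 < T c" if "c \<in> S" "c \<noteq> (2, 1)" for c
    using that SYT_range[of c] SYT_inj[of c "(2, 1)"] assms b_pos by (auto simp: in_S_iff le_less)
  have "bij_betw ?\<tau> (S - {(2, b)}) (S - {(2, 1)})"
    by (rule bij_betw_byWitness[where f' = "\<lambda>c. if fst c = 2 then (2, snd c - 1) else c"])
      (use b_pos b_less in \<open>auto simp: ribbon_def right_of_def\<close>)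
  then have "bij_betw (promotion S T) S {1..m}"
    unfolding p using SYT_bij assms b_pos
    by (intro bij_betw_decrement[of T S m "(2, 1)"]) (auto simp: in_S_iff)
  moreover have "strict_mono_on {b..<m} (\<lambda>j. promotion S T (1, j))"
  proof (rule strict_mono_onI)
    fix j k assume jk: "j \<in> {b..<m}" "k \<in> {b..<m}" "j < k"
    then show "promotion S T (1, j) < promotion S T (1, k)"
      unfolding p using top_less[of j k] gt1[of "(1, j)"]
      by (auto simp: in_S_iff intro!: diff_less_mono)
  qed
  moreover have "strict_mono_on {1..b} (\<lambda>j. promotion S T (2, j))"
  proof (rule strict_mono_onI)
    fix j k assume jk: "j \<in> {1..b}" "k \<in> {1..b}" "j < k"
    have "1 < T (2, Suc j)" "T (2, Suc j) \<le> m"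
      using jk gt1[of "(2, Suc j)"] SYT_range[of "(2, Suc j)"] by (auto simp: in_S_iff)
    then show "promotion S T (2, j) < promotion S T (2, k)"
      unfolding p using jk bottom_less[of "Suc j" "Suc k"]
      by (auto simp: in_S_iff right_of_def intro!: diff_less_mono)
  qed
  moreover have "promotion S T (1, b) < promotion S T (2, b)"
    unfolding p using b_less SYT_range[of "(1, b)"] by (auto simp: in_S_iff)
  ultimately show "promotion S T \<in> SYT S" unfolding SYT_iff using b_pos by (auto simp: p in_S_iff)
  \<comment> \<open>The new row ends with \<open>m\<close>; the old row begins with 1, which
    \<open>cyclic_pred\<close> sends to \<open>m\<close>. The two decompositions align the other
    columns up to a shift by one.\<close>
  have split: "{1..b} = insert b {1..<b}" "{1..b} = insert 1 {2..b}" using b_pos by auto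
  have "bottom_entries b (promotion S T) = insert m ((\<lambda>j. T (2, Suc j) - 1) ` {1..<b})"
    unfolding p bottom_entries_def split(1) by (auto simp: in_S_iff right_of_def)
  moreover have "cyclic_pred m ` bottom_entries b T
      = insert m ((\<lambda>j. cyclic_pred m (T (2, j))) ` {2..b})"
    unfolding bottom_entries_def split(2) image_image image_insert assms
    by (simp only: cyclic_pred_def if_True refl)
  moreover have "(\<lambda>j. cyclic_pred m (T (2, j))) ` {2..b} = (\<lambda>j. T (2, Suc j) - 1) ` {1..<b}"
  proof -
    have "{2..b} = Suc ` {1..<b}"
      by (simp add: atLeastLessThanSuc_atLeastAtMost numeral_2_eq_2)
    moreover have "cyclic_pred m (T (2, Suc j)) = T (2, Suc j) - 1" if "j \<in> {1..<b}" for j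
      using that gt1[of "(2, Suc j)"] by (auto simp: cyclic_pred_def in_S_iff)
    ultimately show ?thesis by (simp only: image_image cong: image_cong)
  qed
  ultimately show "bottom_entries b (promotion S T) = cyclic_pred m ` bottom_entries b T"
    by simp
qed

text \<open>Here 1 lies in the top row, so no bottom entry moves and \<open>cyclic_pred\<close> just
  decrements them. The last assumption, decremented, is the corner inequality of the result.\<close>

lemma promotion_top_properties:
  assumes "T (1, b) = 1" and "Suc b < m" and "T (1, Suc b) < T (2, b)"
  shows "promotion S T \<in> SYT S"
    and "bottom_entries b (promotion S T) = cyclic_pred m ` bottom_entries b T"
proof -
  let ?\<tau> = "\<lambda>c. if fst c = 1 then right_of c else c"
  note p = promotion_top[OF assms]
  have gt1: "1 < T c" if "c \<in> S" "c \<noteq> (1, b)" for c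
    using that SYT_range[of c] SYT_inj[of c "(1, b)"] assms by (auto simp: in_S_iff le_less)
  have "bij_betw ?\<tau> (S - {(1, m - 1)}) (S - {(1, b)})"
    by (rule bij_betw_byWitness[where f' = "\<lambda>c. if fst c = 1 then (1, snd c - 1) else c"])
      (use b_pos b_less in \<open>auto simp: ribbon_def right_of_def\<close>)
  then have "bij_betw (promotion S T) S {1..m}"
    unfolding p using SYT_bij assms b_pos
    by (intro bij_betw_decrement[of T S m "(1, b)"]) (auto simp: in_S_iff)
  moreover have "strict_mono_on {b..<m} (\<lambda>j. promotion S T (1, j))"
  proof (rule strict_mono_onI)
    fix j k assume jk: "j \<in> {b..<m}" "k \<in> {b..<m}" "j < k"
    have "1 < T (1, Suc j)" "T (1, Suc j) \<le> m"
      using jk gt1[of "(1, Suc j)"] SYT_range[of "(1, Suc j)"] by (auto simp: in_S_iff)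
    then show "promotion S T (1, j) < promotion S T (1, k)"
      unfolding p using jk top_less[of "Suc j" "Suc k"]
      by (auto simp: in_S_iff right_of_def intro!: diff_less_mono)
  qed
  moreover have "strict_mono_on {1..b} (\<lambda>j. promotion S T (2, j))"
  proof (rule strict_mono_onI)
    fix j k assume jk: "j \<in> {1..b}" "k \<in> {1..b}" "j < k"
    then show "promotion S T (2, j) < promotion S T (2, k)"
      unfolding p using bottom_less[of j k] gt1[of "(2, j)"]
      by (auto simp: in_S_iff intro!: diff_less_mono)
  qed
  moreover have "promotion S T (1, b) < promotion S T (2, b)"
    unfolding p using assms b_pos gt1[of "(1, Suc b)"]
    by (auto simp: in_S_iff right_of_def intro!: diff_less_mono)
  ultimately show "promotion S T \<in> SYT S" unfolding SYT_iff using assms by (auto simp: p in_S_iff)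
  have "cyclic_pred m (T (2, j)) = promotion S T (2, j)" if "j \<in> {1..b}" for j
    using that gt1[of "(2, j)"] by (auto simp: cyclic_pred_def in_S_iff p)
  then show "bottom_entries b (promotion S T) = cyclic_pred m ` bottom_entries b T"
    unfolding bottom_entries_def image_image by (intro image_cong) simp_all
qed

text \<open>The exceptional step. The bottom entries are forced to be \<open>{2..Suc b}\<close>,
  whose rotation is the missing set. The slide yields \<open>{1..<b}\<close> with \<open>m\<close>
  added, the rotation of the missing set itself.\<close>

lemma promotion_corner_properties:
  assumes "T (1, b) = 1" and "\<not> (Suc b < m \<and> T (1, Suc b) < T (2, b))"
  shows "promotion S T \<in> SYT S"
    and "cyclic_pred m ` bottom_entries b T = {1..b}"
    and "bottom_entries b (promotion S T) = cyclic_pred m ` {1..b}"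
proof -
  let ?\<tau> = "\<lambda>c. if c = (1, b) then (2, b) else c"
  note p = promotion_corner[OF assms]
  have gt1: "1 < T c" if "c \<in> S" "c \<noteq> (1, b)" for c
    using that SYT_range[of c] SYT_inj[of c "(1, b)"] assms b_less by (auto simp: in_S_iff le_less)
  \<comment> \<open>Since entries are distinct, the failed comparison is a strict inequality the
    other way, and it extends along the top row.\<close>
  have corner: "T (2, b) < T (1, j)" if "b < j" "j < m" for j
  proof -
    have "T (2, b) < T (1, Suc b)"
      using assms(2) that SYT_inj[of "(2, b)" "(1, Suc b)"] b_pos by (auto simp: in_S_iff)
    also have "T (1, Suc b) \<le> T (1, j)" using that top_less[of "Suc b" j] by (cases "j = Suc b") auto
    finally show ?thesis .
  qed
  have "bij_betw ?\<tau> (S - {(2, b)}) (S - {(1, b)})"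
    by (rule bij_betw_byWitness[where f' = "\<lambda>c. if c = (2, b) then (1, b) else c"])
      (use b_pos b_less in \<open>auto simp: in_S_iff\<close>)
  then have "bij_betw (promotion S T) S {1..m}"
    unfolding p using SYT_bij assms b_pos b_less
    by (intro bij_betw_decrement[of T S m "(1, b)"]) (auto simp: in_S_iff)
  moreover have "strict_mono_on {b..<m} (\<lambda>j. promotion S T (1, j))"
  proof (rule strict_mono_onI)
    fix j k assume jk: "j \<in> {b..<m}" "k \<in> {b..<m}" "j < k"
    then show "promotion S T (1, j) < promotion S T (1, k)"
      unfolding p using top_less[of j k] gt1[of "(1, j)"] gt1[of "(2, b)"] corner[of k] b_pos
      by (auto simp: in_S_iff intro!: diff_less_mono)
  qed
  moreover have "strict_mono_on {1..b} (\<lambda>j. promotion S T (2, j))"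
  proof (rule strict_mono_onI)
    fix j k assume jk: "j \<in> {1..b}" "k \<in> {1..b}" "j < k"
    have "1 < T (2, j)" "T (2, j) \<le> m"
      using jk gt1[of "(2, j)"] SYT_range[of "(2, j)"] by (auto simp: in_S_iff)
    then show "promotion S T (2, j) < promotion S T (2, k)"
      unfolding p using jk bottom_less[of j k]
      by (auto simp: in_S_iff intro!: diff_less_mono)
  qed
  moreover have "promotion S T (1, b) < promotion S T (2, b)"
    unfolding p using b_less b_pos SYT_range[of "(2, b)"] by (auto simp: in_S_iff)
  ultimately show "promotion S T \<in> SYT S" unfolding SYT_iff using b_pos by (auto simp: p in_S_iff)

  \<comment> \<open>A number of this interval outside the bottom row would be a top entry, but those
    are 1 or larger than \<open>T (2, b)\<close>.\<close>
  have bot: "bottom_entries b T = {2..T (2, b)}"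
  proof (intro set_eqI iffI)
    fix x assume "x \<in> bottom_entries b T"
    then obtain j where j: "x = T (2, j)" "1 \<le> j" "j \<le> b" by (auto simp: bottom_entries_def)
    then show "x \<in> {2..T (2, b)}"
      using gt1[of "(2, j)"] bottom_less[of j b] by (cases "j = b") (auto simp: in_S_iff)
  next
    fix x assume x: "x \<in> {2..T (2, b)}"
    show "x \<in> bottom_entries b T"
    proof (rule ccontr)
      assume "x \<notin> bottom_entries b T"
      moreover have "x \<in> {1..m}" using x SYT_range[of "(2, b)"] b_pos by (auto simp: in_S_iff)
      ultimately have "x \<in> (\<lambda>j. T (1, j)) ` {b..<m}" unfolding top_entries by simp
      then obtain j where "x = T (1, j)" "b \<le> j" "j < m" by auto
      then show False using x corner[of j] assms(1) by (cases "j = b") auto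
    qed
  qed
  \<comment> \<open>The bottom row has \<open>b\<close> entries, which fixes the upper end of the
    interval.\<close>
  then have v: "T (2, b) = Suc b" using card_bottom_entries b_pos by simp
  have "cyclic_pred m ` {2..Suc b} = (\<lambda>x. x - 1) ` Suc ` {1..b}"
    by (rule image_cong) (auto simp: cyclic_pred_def numeral_2_eq_2)
  also have "\<dots> = {1..b}" by (simp only: image_image diff_Suc_1 image_ident)
  finally show "cyclic_pred m ` bottom_entries b T = {1..b}" by (simp only: bot v)

  have split: "{1..b} = insert b {1..<b}" "{1..b} = insert 1 {2..b}" using b_pos by auto
  have "bottom_entries b (promotion S T) = insert m ((\<lambda>j. T (2, j) - 1) ` {1..<b})"
    unfolding bottom_entries_def p split(1) by (auto simp: in_S_iff)
  \<comment> \<open>The entry \<open>Suc b\<close> has moved up to the corner, so its decrement is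
    absent from the new bottom row.\<close>
  also have "(\<lambda>j. T (2, j) - 1) ` {1..<b} = (\<lambda>x. x - 1) ` ({2..Suc b} - {Suc b})"
  proof -
    have "bottom_entries b T - {T (2, b)} = (\<lambda>j. T (2, j)) ` {1..<b}"
      unfolding bottom_entries_def split(1) using bottom_less b_pos by force
    then have "{2..Suc b} - {Suc b} = (\<lambda>j. T (2, j)) ` {1..<b}" by (simp only: bot v)
    then show ?thesis by (simp only: image_image)
  qed
  also have "{2..Suc b} - {Suc b} = {2..b}" by auto
  also have "insert m ((\<lambda>x. x - 1) ` {2..b}) = cyclic_pred m ` {1..b}"
    unfolding split(2) by (auto simp: cyclic_pred_def)
  finally show "bottom_entries b (promotion S T) = cyclic_pred m ` {1..b}" .
qed

end

text \<open>Sorting a set and its complement into the two rows is the only possible filling, and it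
  can violate only the corner inequality.\<close>

lemma bij_betw_bottom_entries:
  "bij_betw (bottom_entries b) (SYT S) ({B. B \<subseteq> {1..m} \<and> card B = b} - {{1..b}})"
  unfolding bij_betw_def
proof
  have bb: "{1..b} = {1..<Suc b}" by auto
  show "inj_on (bottom_entries b) (SYT S)"
  proof (rule inj_onI)
    fix T U assume TU: "T \<in> SYT S" "U \<in> SYT S" "bottom_entries b T = bottom_entries b U"
    have 2: "T (2, j) = U (2, j)" if "j \<in> {1..b}" for j
      using strict_mono_on_image_unique[of 1 "Suc b" "\<lambda>j. T (2, j)" "\<lambda>j. U (2, j)" j]
        SYT_bottom[OF TU(1)] SYT_bottom[OF TU(2)] TU(3) that
      unfolding bottom_entries_def bb by blast
    have 1: "T (1, j) = U (1, j)" if "j \<in> {b..<m}" for j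
      using strict_mono_on_image_unique[of b m "\<lambda>j. T (1, j)" "\<lambda>j. U (1, j)" j]
        SYT_top[OF TU(1)] SYT_top[OF TU(2)] top_entries[OF TU(1)] top_entries[OF TU(2)] TU(3) that
      by metis
    show "T = U"
    proof
      fix c
      show "T c = U c"
        using 1 2 SYT_outside[OF TU(1)] SYT_outside[OF TU(2)] by (cases "c \<in> S") (auto simp: S_eq)
    qed
  qed
  show "bottom_entries b ` SYT S = {B. B \<subseteq> {1..m} \<and> card B = b} - {{1..b}}"
  proof (intro equalityI subsetI)
    fix B assume "B \<in> bottom_entries b ` SYT S"
    then show "B \<in> {B. B \<subseteq> {1..m} \<and> card B = b} - {{1..b}}"
      using bottom_entries_subset card_bottom_entries bottom_entries_neq by blast
  next
    fix B assume "B \<in> {B. B \<subseteq> {1..m} \<and> card B = b} - {{1..b}}"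
    then have B: "B \<subseteq> {1..m}" "card B = b" "B \<noteq> {1..b}" by auto
    have fin: "finite B" using B(1) finite_subset by blast
    let ?C = "{1..m} - B"
    have C: "finite ?C" "card ?C = m - b" using B by (simp_all add: card_Diff_subset fin)
    obtain f where f: "strict_mono_on {1..b} f" "f ` {1..b} = B"
      using strict_mono_on_enumeration[OF fin, of 1] B(2) unfolding bb by auto
    obtain g where g: "strict_mono_on {b..<m} g" "g ` {b..<m} = ?C"
      using strict_mono_on_enumeration[OF C(1), of b] C(2) b_less by auto
    \<comment> \<open>Otherwise the least element of the complement is at least the greatest element
      of \<open>B\<close>. Then \<open>B\<close> is an initial segment, hence \<open>{1..b}\<close>
      by its size.\<close>
    have corner: "g b < f b"
    proof (rule ccontr)
      assume gf: "\<not> g b < f b"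
      have "B = {1..f b}"
      proof (intro set_eqI iffI)
        fix x assume x: "x \<in> B"
        then obtain j where "j \<in> {1..b}" "x = f j" using f(2) by auto
        then have "x \<le> f b" using strict_mono_onD[OF f(1), of j b] by (cases "j = b") auto
        then show "x \<in> {1..f b}" using x B(1) by auto
      next
        fix x assume x: "x \<in> {1..f b}"
        have fb: "f b \<in> B" using f(2) b_pos by auto
        show "x \<in> B"
        proof (rule ccontr)
          assume "x \<notin> B"
          then have "x \<in> g ` {b..<m}" using x fb B(1) g(2) by auto
          then obtain j where "j \<in> {b..<m}" "x = g j" by auto
          then have "g b \<le> x" using strict_mono_onD[OF g(1), of b j] by (cases "j = b") auto
          then have "x = f b" using gf x by auto
          then show False using fb \<open>x \<notin> B\<close> by simp
        qed
      qed
      moreover from this have "f b = b" using B(2) by (metis card_atLeastAtMost diff_Suc_1)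
      ultimately show False using B(3) by simp
    qed
    define T where "T = (\<lambda>c. if c \<in> S then (if fst c = 2 then f (snd c) else g (snd c)) else 0)"
    have T1: "T (1, j) = g j" if "j \<in> {b..<m}" for j using that by (simp add: T_def in_S_iff)
    have T2: "T (2, j) = f j" if "j \<in> {1..b}" for j using that by (simp add: T_def in_S_iff)
    have "(\<lambda>j. T (1, j)) ` {b..<m} = g ` {b..<m}" by (rule image_cong[OF refl T1])
    moreover have bot: "(\<lambda>j. T (2, j)) ` {1..b} = f ` {1..b}" by (rule image_cong[OF refl T2])
    ultimately have "T ` S = g ` {b..<m} \<union> f ` {1..b}"
      unfolding S_eq image_Un image_image by (simp only:)
    also have "\<dots> = {1..m}" using f g B by auto
    \<comment> \<open>There are \<open>m\<close> cells and \<open>m\<close> values, so surjectivity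
      gives injectivity.\<close>
    finally have "bij_betw T S {1..m}"
      by (simp add: bij_betw_def eq_card_imp_inj_on finite_S card_S)
    moreover have "strict_mono_on {b..<m} (\<lambda>j. T (1, j))" "strict_mono_on {1..b} (\<lambda>j. T (2, j))"
      using f(1) g(1) T1 T2 by (simp_all add: strict_mono_on_def)
    moreover have "T (1, b) < T (2, b)" using T1[of b] T2[of b] corner b_pos b_less by simp
    moreover have "\<forall>c. c \<notin> S \<longrightarrow> T c = 0" by (simp add: T_def)
    ultimately have "T \<in> SYT S" unfolding SYT_iff by blast
    moreover have "bottom_entries b T = B" 
      unfolding bottom_entries_def bot f(2) ..
    ultimately show "B \<in> bottom_entries b ` SYT S" by blast
  qed
qed

end

section \<open>Promotion as rotation\<close>

text \<open>Entries are numbered from 1, residues from 0.\<close>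

definition word :: "nat \<Rightarrow> nat set \<Rightarrow> int \<Rightarrow> bool" where
  "word m B = (\<lambda>x. Suc (nat (x mod int m)) \<in> B)"

lemma word_atLeastAtMost: "0 < m \<Longrightarrow> word m {1..b} = arc m b 0"
  by (auto simp: word_def arc_def fun_eq_iff Suc_le_eq nat_less_iff)

lemma bij_betw_word:
  assumes "0 < m"
  shows "bij_betw (word m) {B. B \<subseteq> {1..m} \<and> card B = b} (words m b)"
proof (rule bij_betw_byWitness[where f' = "\<lambda>f. {i \<in> {1..m}. f (int i - 1)}"])
  let ?W = "\<lambda>f. {i \<in> {1..m}. f (int i - 1)}"
  have card: "card (?W f) = card {x \<in> {0..<int m}. f x}" for f
    by (rule bij_betw_same_card[where f = "\<lambda>i. int i - 1"],
        rule bij_betw_byWitness[where f' = "\<lambda>x. Suc (nat x)"]) auto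
  have W: "?W (word m B) = B" if "B \<subseteq> {1..m}" for B
  proof -
    have "word m B (int i - 1) \<longleftrightarrow> i \<in> B" if "i \<in> {1..m}" for i
    proof -
      have "(int i - 1) mod int m = int i - 1" using that by simp
      moreover have "Suc (nat (int i - 1)) = i" using that by auto
      ultimately show ?thesis by (simp add: word_def)
    qed
    then show ?thesis using that by blast
  qed
  show "\<forall>B\<in>{B. B \<subseteq> {1..m} \<and> card B = b}. ?W (word m B) = B" using W by blast
  show "\<forall>f\<in>words m b. word m (?W f) = f"
  proof
    fix f assume "f \<in> words m b"
    then have p: "shift (int m) f = f" by (simp add: words_def)
    show "word m (?W f) = f"
    proof
      fix x
      have "0 \<le> x mod int m" "x mod int m < int m" using assms by simp_all
      then show "word m (?W f) x = f x"
        using shift_period_mod[OF p, of x] by (auto simp: word_def Suc_le_eq nat_less_iff)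
    qed
  qed
  show "word m ` {B. B \<subseteq> {1..m} \<and> card B = b} \<subseteq> words m b"
  proof safe
    fix B assume B: "B \<subseteq> {1..m}"
    have "card {x \<in> {0..<int m}. word m B x} = card B" using card[of "word m B"] W[OF B] by simp
    then show "word m B \<in> words m (card B)" by (simp add: words_def shift_def word_def)
  qed
  show "?W ` words m b \<subseteq> {B. B \<subseteq> {1..m} \<and> card B = b}"
    using card by (auto simp: words_def)
qed

text \<open>A number belongs to the lowered set when its cyclic successor belongs to
  \<open>B\<close>. This is why lowering entries shifts the argument by +1.\<close>

lemma word_cyclic_pred:
  assumes "0 < m" and B: "B \<subseteq> {1..m}"
  shows "word m (cyclic_pred m ` B) = shift 1 (word m B)"
proof
  fix x
  define r where "r = nat (x mod int m)"
  have r: "r < m" using assms(1) by (simp add: r_def nat_less_iff)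
  have "int r = x mod int m" using assms(1) by (simp add: r_def)
  then have "(x + 1) mod int m = (int r + 1) mod int m" by (simp add: mod_add_left_eq)
  also have "\<dots> = int (Suc r mod m)" by (simp add: zmod_int add.commute)
  also have "Suc r mod m = (if Suc r = m then 0 else Suc r)" using r by simp
  finally have succ: "Suc (nat ((x + 1) mod int m)) = (if Suc r = m then 1 else Suc (Suc r))"
    by simp
  have "Suc r \<in> cyclic_pred m ` B \<longleftrightarrow> (if Suc r = m then 1 else Suc (Suc r)) \<in> B"
  proof
    assume "Suc r \<in> cyclic_pred m ` B"
    then obtain y where "y \<in> B" "Suc r = cyclic_pred m y" by auto
    moreover from this have "1 \<le> y" "y \<le> m" using B by auto
    ultimately show "(if Suc r = m then 1 else Suc (Suc r)) \<in> B"
      by (auto simp: cyclic_pred_def split: if_splits)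
  next
    assume "(if Suc r = m then 1 else Suc (Suc r)) \<in> B"
    then show "Suc r \<in> cyclic_pred m ` B"
      by (rule rev_image_eqI) (simp add: cyclic_pred_def)
  qed
  then show "word m (cyclic_pred m ` B) x = shift 1 (word m B) x"
    unfolding word_def shift_def succ r_def .
qed

context two_row_ribbon
begin

definition tableau_word :: "(cell \<Rightarrow> nat) \<Rightarrow> int \<Rightarrow> bool" where
  "tableau_word T = word m (bottom_entries b T)"

lemma m_pos: "0 < m"
  using b_less by simp

lemma bij_betw_tableau_word:
  "bij_betw tableau_word (SYT S) (words m b - {arc m b 0})"
proof -
  have "bij_betw (word m) {{1..b}} {arc m b 0}"
    unfolding bij_betw_def word_atLeastAtMost[OF m_pos, symmetric] by simp
  moreover have "{{1..b}} \<subseteq> {B. B \<subseteq> {1..m} \<and> card B = b}" using b_less by auto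
  moreover have "{arc m b 0} \<subseteq> words m b" using arc_in_words b_less by simp
  ultimately have "bij_betw (word m) ({B. B \<subseteq> {1..m} \<and> card B = b} - {{1..b}}) (words m b - {arc m b 0})"
    by (rule bij_betw_DiffI[OF bij_betw_word[OF m_pos]])
  then have "bij_betw (word m \<circ> bottom_entries b) (SYT S) (words m b - {arc m b 0})"
    using bij_betw_trans[OF bij_betw_bottom_entries] by blast
  moreover have "word m \<circ> bottom_entries b = tableau_word"
    by (simp add: fun_eq_iff tableau_word_def)
  ultimately show ?thesis by simp
qed

lemma tableau_word_in: "T \<in> SYT S \<Longrightarrow> tableau_word T \<in> words m b - {arc m b 0}"
  using bij_betw_tableau_word by (rule bij_betwE[THEN bspec])

text \<open>Conjugates promotion to \<open>skip_shift\<close>; the downward slide at the corner is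
  the exceptional branch.\<close>

lemma promotion_in_SYT_and_tableau_word:
  assumes T: "T \<in> SYT S"
  shows "promotion S T \<in> SYT S \<and> tableau_word (promotion S T) = skip_shift m b (tableau_word T)"
proof -
  note shift = word_cyclic_pred[OF m_pos bottom_entries_subset[OF T]]
  consider "T (2, 1) = 1" | "T (1, b) = 1" "Suc b < m" "T (1, Suc b) < T (2, b)"
    | "T (1, b) = 1" "\<not> (Suc b < m \<and> T (1, Suc b) < T (2, b))"
    using one_cases[OF T] by blast
  then show ?thesis
  proof cases
    case 3
    note c = promotion_corner_properties[OF T 3]
    have "{1..b} \<subseteq> {1..m}" using b_less by auto
    from word_cyclic_pred[OF m_pos this] have "tableau_word (promotion S T) = shift 1 (arc m b 0)"
      unfolding tableau_word_def c(3) by (simp only: word_atLeastAtMost[OF m_pos])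
    moreover have "shift 1 (tableau_word T) = arc m b 0"
      unfolding tableau_word_def shift[symmetric] c(2) by (rule word_atLeastAtMost[OF m_pos])
    ultimately show ?thesis using c(1) by (simp add: skip_shift_def)
  next
    case 1
    note c = promotion_bottom_properties[OF T 1]
    have "tableau_word (promotion S T) = shift 1 (tableau_word T)"
      unfolding tableau_word_def c(2) shift ..
    \<comment> \<open>The rotated word is the word of a tableau, hence not \<open>arc m b 0\<close>,
      and \<open>skip_shift\<close> takes its regular branch.\<close>
    then show ?thesis using c(1) tableau_word_in[OF c(1)] by (simp add: skip_shift_def)
  next
    case 2
    note c = promotion_top_properties[OF T 2]
    have "tableau_word (promotion S T) = shift 1 (tableau_word T)"
      unfolding tableau_word_def c(2) shift ..
    then show ?thesis using c(1) tableau_word_in[OF c(1)] by (simp add: skip_shift_def)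
  qed
qed

section \<open>The orbits of promotion\<close>

lemma promotion_funpow:
  assumes T: "T \<in> SYT S"
  shows "(promotion S ^^ n) T \<in> SYT S"
    and "tableau_word ((promotion S ^^ n) T) = (skip_shift m b ^^ n) (tableau_word T)"
  by (induction n) (use T promotion_in_SYT_and_tableau_word in auto)

lemma promotion_funpow_fixed_iff_skip_shift:
  assumes T: "T \<in> SYT S"
  shows "(promotion S ^^ n) T = T \<longleftrightarrow> (skip_shift m b ^^ n) (tableau_word T) = tableau_word T"
  using inj_on_eq_iff[OF bij_betw_imp_inj_on[OF bij_betw_tableau_word] promotion_funpow(1)[OF T] T]
  by (simp add: promotion_funpow(2)[OF T])

lemma promotion_funpow_fixed_iff:
  assumes T: "T \<in> SYT S"
  shows "(promotion S ^^ n) T = T \<longleftrightarrow>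
    (if tableau_word T \<in> arcs m b then (m - 1) dvd n else shift (int n) (tableau_word T) = tableau_word T)"
  unfolding promotion_funpow_fixed_iff_skip_shift[OF T]
  using tableau_word_in[OF T] b_pos b_less by (intro skip_shift_funpow_fixed_iff) auto

lemma finite_SYT: "finite (SYT S)"
  using bij_betw_finite[OF bij_betw_tableau_word] finite_words[OF m_pos] by simp

lemma card_SYT: "card (SYT S) = (m choose b) - 1"
  using bij_betw_same_card[OF bij_betw_tableau_word] arc_in_words[of b m 0] b_less m_pos
  by (simp add: card_words)

text \<open>The exponent is a multiple of \<open>m - 1\<close>, which suffices on the arcs, and of
  \<open>m\<close>, which suffices elsewhere.\<close>

lemma promotion_period:
  assumes T: "T \<in> SYT S"
  shows "(promotion S ^^ (m * (m - 1))) T = T"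
proof -
  have p: "shift (int m) (tableau_word T) = tableau_word T"
    using tableau_word_in[OF T] by (simp add: words_def)
  have "shift (int (m * (m - 1))) (tableau_word T) = tableau_word T"
    by (rule shift_period_dvd[OF p]) simp
  then show ?thesis by (simp only: promotion_funpow_fixed_iff[OF T] dvd_triv_right if_cancel) simp
qed

text \<open>Injectivity comes from finite order instead of reversing the slide: the power with
  exponent \<open>m * (m - 1) - 1\<close> is a left inverse. Finiteness gives surjectivity.\<close>

lemma bij_betw_promotion: "bij_betw (promotion S) (SYT S) (SYT S)"
proof -
  have maps: "promotion S ` SYT S \<subseteq> SYT S" using promotion_in_SYT_and_tableau_word by blast
  obtain k where k: "m * (m - 1) = Suc k" using b_pos b_less by (cases "m * (m - 1)") auto
  have "inj_on (promotion S) (SYT S)"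
  proof (rule inj_on_inverseI)
    fix T assume "T \<in> SYT S"
    then show "(promotion S ^^ k) (promotion S T) = T"
      using promotion_period[of T] unfolding k by (simp add: funpow_swap1)
  qed
  then show ?thesis using endo_inj_surj[OF finite_SYT maps] by (simp add: bij_betw_def)
qed

lemma card_promotion_fixed:
  "card {T \<in> SYT S. (promotion S ^^ n) T = T} + (if m dvd n then m else 0)
    = (if (m - 1) dvd n then m - 1 else 0) + card {f \<in> words m b. shift (int n) f = f}"
proof -
  have "bij_betw tableau_word {T \<in> SYT S. (promotion S ^^ n) T = T}
      {f \<in> words m b - {arc m b 0}. (skip_shift m b ^^ n) f = f}"
  proof (rule bij_betw_subset[OF bij_betw_tableau_word])
    show "tableau_word ` {T \<in> SYT S. (promotion S ^^ n) T = T}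
        = {f \<in> words m b - {arc m b 0}. (skip_shift m b ^^ n) f = f}"
      unfolding bij_betw_imp_surj_on[OF bij_betw_tableau_word, symmetric]
      using promotion_funpow_fixed_iff_skip_shift by auto
  qed blast
  from bij_betw_same_card[OF this] show ?thesis
    using card_skip_shift_fixed[of b m n] b_pos b_less by simp
qed

text \<open>The tableaux whose bottom entries form a cyclic interval; they make up the orbit of size
  \<open>m - 1\<close>.\<close>

definition special :: "(cell \<Rightarrow> nat) set" where
  "special = {T \<in> SYT S. tableau_word T \<in> arcs m b}"

lemma card_orbit_special: "T \<in> special \<Longrightarrow> card (orbit (promotion S) T) = m - 1"
  using b_pos b_less promotion_funpow_fixed_iff[of T]
  by (intro card_orbit_eq_period) (auto simp: special_def)

lemma orbit_special:
  assumes T: "T \<in> special"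
  shows "orbit (promotion S) T = special"
proof
  note arcs = arcs_minus_eq_range_skip_arc[of b m]
  have bm: "0 < b" "b < m" using b_pos b_less by auto
  have sk: "tableau_word U \<in> range (skip_arc m b)" if "U \<in> special" for U
    using that tableau_word_in[of U] arcs[OF bm] by (auto simp: special_def)
  have SYT: "T \<in> SYT S" using T by (simp add: special_def)
  obtain k where k: "tableau_word T = skip_arc m b k" using sk[OF T] by auto
  have pow: "tableau_word ((promotion S ^^ n) T) = skip_arc m b (k + n)" for n
    using promotion_funpow(2)[OF SYT] skip_shift_funpow_skip_arc[OF bm] k by simp
  show "orbit (promotion S) T \<subseteq> special"
    using promotion_funpow(1)[OF SYT] pow
    by (auto simp: orbit_altdef special_def skip_arc_def arcs_def)
  show "special \<subseteq> orbit (promotion S) T"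
  proof
    fix U assume U: "U \<in> special"
    then obtain l where l: "tableau_word U = skip_arc m b l" using sk by auto
    \<comment> \<open>Modulo \<open>m - 1\<close> the term \<open>k * (m - 2)\<close> is
      \<open>-k\<close>, so \<open>k + n\<close> agrees with \<open>l\<close>. The last summand
      makes \<open>n\<close> positive, as \<open>orbit\<close> requires.\<close>
    define n where "n = l + k * (m - 2) + (m - 1)"
    have "k + n = l + (k + 1) * (m - 1)"
    proof -
      have "m - 1 = Suc (m - 2)" using bm by simp
      then have "k * (m - 2) + k = k * (m - 1)" by simp
      moreover have "k + n = l + (k * (m - 2) + k) + (m - 1)" by (simp add: n_def)
      ultimately show ?thesis by simp
    qed
    then have "skip_arc m b (k + n) = skip_arc m b l"
      unfolding skip_arc_eq_iff[OF bm] by (simp only: mod_mult_self1)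
    then have "tableau_word ((promotion S ^^ n) T) = tableau_word U" by (simp only: pow l)
    then have "(promotion S ^^ n) T = U"
      using inj_onD[OF bij_betw_imp_inj_on[OF bij_betw_tableau_word]] promotion_funpow(1)[OF SYT] U
      by (auto simp: special_def)
    moreover have "0 < n" using bm by (simp add: n_def)
    ultimately show "U \<in> orbit (promotion S) T" by (auto simp: orbit_altdef)
  qed
qed

lemma special_nonempty: "special \<noteq> {}"
proof -
  have bm: "0 < b" "b < m" using b_pos b_less by auto
  have "skip_arc m b 0 \<in> arcs m b - {arc m b 0}"
    unfolding arcs_minus_eq_range_skip_arc[OF bm] by simp
  then have "skip_arc m b 0 \<in> words m b - {arc m b 0}"
    using arcs_subset_words[of b m] bm by auto
  then have "skip_arc m b 0 \<in> tableau_word ` SYT S"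
    unfolding bij_betw_imp_surj_on[OF bij_betw_tableau_word] .
  then obtain T where "T \<in> SYT S" "tableau_word T = skip_arc m b 0" by auto
  then show ?thesis by (auto simp: special_def skip_arc_def arcs_def)
qed

lemma card_orbit_not_special:
  assumes T: "T \<in> SYT S" "T \<notin> special"
  shows "card (orbit (promotion S) T) dvd m"
proof -
  have f: "shift (int m) (tableau_word T) = tableau_word T"
    using tableau_word_in[OF T(1)] by (simp add: words_def)
  have m: "(promotion S ^^ m) T = T"
    using promotion_funpow_fixed_iff[OF T(1), of m] T f by (simp add: special_def)
  then obtain k where k: "0 < k" "\<And>n. (promotion S ^^ n) T = T \<longleftrightarrow> k dvd n"
    using least_period_exists[OF m m_pos] by metis
  then have "card (orbit (promotion S) T) = k" by (rule card_orbit_eq_period)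
  then show ?thesis using k(2) m by simp
qed

lemma ex1_orbit_card: "\<exists>!A. A \<in> orbit (promotion S) ` SYT S \<and> card A = m - 1"
proof
  obtain T where T: "T \<in> special" using special_nonempty by auto
  have card_special: "card special = m - 1" using card_orbit_special[OF T] orbit_special[OF T] by simp
  have "special \<subseteq> SYT S" by (auto simp: special_def)
  then show "special \<in> orbit (promotion S) ` SYT S \<and> card special = m - 1"
    using T orbit_special[OF T] card_special by blast
  fix A assume "A \<in> orbit (promotion S) ` SYT S \<and> card A = m - 1"
  then obtain U where U: "A = orbit (promotion S) U" "U \<in> SYT S" "card A = m - 1" by auto
  have "U \<in> special"
  proof (rule ccontr)
    assume "U \<notin> special"
    then have "m - 1 dvd m" using card_orbit_not_special[OF U(2)] U by simp
    \<comment> \<open>Dividing two consecutive numbers forces \<open>m - 1 = 1\<close>. For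
      \<open>m = 2\<close> there is just one tableau, and it is special.\<close>
    then have "m - 1 dvd m - (m - 1)" by (rule dvd_diff_nat) simp
    then have "m - 1 = 1" using b_pos b_less by simp
    then have m: "m = 2" "b = 1" using b_pos b_less by auto
    then have "(m choose b) - 1 = m - 1" by simp
    then have "card (SYT S) = card special" by (simp only: card_SYT card_special)
    then have "special = SYT S" using \<open>special \<subseteq> SYT S\<close> finite_SYT by (simp add: card_subset_eq)
    then show False using U(2) \<open>U \<notin> special\<close> by simp
  qed
  then show "A = special" using orbit_special U by simp
qed

lemma orbit_card_dvd:
  assumes "A \<in> orbit (promotion S) ` SYT S" and "card A \<noteq> m - 1"
  shows "card A dvd m"
  using assms card_orbit_special card_orbit_not_special by blast

end

section \<open>Fixed words and powers of a primitive root\<close>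

lemma power_int_eq_power_nat_or_inverse:
  fixes z :: complex
  shows "z powi e = z ^ nat \<bar>e\<bar> \<or> z powi e = inverse (z ^ nat \<bar>e\<bar>)"
  by (simp add: power_int_def power_inverse)

lemma primitive_root_of_unity_powi_power_eq_1_iff:
  assumes "primitive_root_of_unity n z"
  shows "(z powi e) ^ k = 1 \<longleftrightarrow> n dvd nat \<bar>e\<bar> * k"
proof -
  have "(z powi e) ^ k = 1 \<longleftrightarrow> z ^ (nat \<bar>e\<bar> * k) = 1"
    using power_int_eq_power_nat_or_inverse[of z e]
    by (auto simp: power_mult power_inverse)
  then show ?thesis using primitive_root_of_unity_power_eq_1_iff[OF assms] by simp
qed

lemma q_eval_q_int_primitive:
  assumes "primitive_root_of_unity n z"
  shows "q_eval (q_int n) (z powi e) = (if n dvd nat \<bar>e\<bar> then of_nat n else 0)"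
proof -
  have "(z powi e) ^ n = 1" "z powi e = 1 \<longleftrightarrow> n dvd nat \<bar>e\<bar>"
    using primitive_root_of_unity_powi_power_eq_1_iff[OF assms, of e n]
      primitive_root_of_unity_powi_power_eq_1_iff[OF assms, of e 1] by simp_all
  then show ?thesis by (simp add: q_eval_q_int_root_of_unity)
qed

text \<open>With \<open>g\<close> the gcd and \<open>l * g\<close> the absolute value of
  \<open>e\<close>, the \<open>k\<close>-th power is 1 iff \<open>d * g\<close> divides
  \<open>l * k * g\<close>. Since \<open>d\<close> and \<open>l\<close> are coprime, this means that
  \<open>d\<close> divides \<open>k\<close>.\<close>

lemma primitive_root_of_unity_powi:
  assumes z: "primitive_root_of_unity m z" and m: "m = d * gcd m (nat \<bar>e\<bar>)"
  shows "primitive_root_of_unity d (z powi e)"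
proof -
  define n g where "n = nat \<bar>e\<bar>" and "g = gcd m n"
  have m: "m = d * g" using m by (simp only: n_def g_def)
  have "0 < m" using z by (simp add: primitive_root_of_unity_def)
  then have pos: "0 < g" "0 < d" using m by (auto intro: gr0I)
  obtain l where l: "n = l * g" by (metis dvd_def gcd_dvd2 g_def mult.commute)
  have "g * gcd d l = g"
    using g_def unfolding m l by (simp add: gcd_mult_distrib_nat mult.commute)
  then have "coprime d l" using pos by (simp add: coprime_iff_gcd_eq_1)
  have "(z powi e) ^ k = 1 \<longleftrightarrow> d dvd k" for k
  proof -
    have "(z powi e) ^ k = 1 \<longleftrightarrow> d * g dvd (l * k) * g"
      using primitive_root_of_unity_powi_power_eq_1_iff[OF z, of e k]
      unfolding n_def[symmetric] m l by (simp add: ac_simps)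
    also have "\<dots> \<longleftrightarrow> d dvd l * k" using pos by simp
    also have "\<dots> \<longleftrightarrow> d dvd k" using \<open>coprime d l\<close> by (simp add: coprime_dvd_mult_right_iff)
    finally show ?thesis .
  qed
  then show ?thesis using pos by (auto simp: primitive_root_of_unity_def dest: dvd_imp_le)
qed

text \<open>Cyclic sieving for \<open>b\<close>-subsets under rotation: the order \<open>d\<close>
  of the root is also the number of periods in a fixed word, so both sides are the same ordinary
  binomial coefficient or 0.\<close>

lemma card_words_fixed_eq_q_binomial:
  assumes z: "primitive_root_of_unity m z"
  shows "of_nat (card {f \<in> words m b. shift e f = f}) = q_eval (q_binomial m b) (z powi e)"
proof -
  have "0 < m" using z by (simp add: primitive_root_of_unity_def)
  obtain d where d: "m = d * gcd m (nat \<bar>e\<bar>)" by (metis dvd_def gcd_dvd1 mult.commute)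
  have "shift e f = f \<longleftrightarrow> shift (int (nat \<bar>e\<bar>)) f = f" for f
    using shift_uminus_eq_iff[of e f] by (cases "0 \<le> e") simp_all
  then have "card {f \<in> words m b. shift e f = f}
      = (if d dvd b then gcd m (nat \<bar>e\<bar>) choose (b div d) else 0)"
    using card_words_fixed[OF d \<open>0 < m\<close>, of b] by simp
  moreover have "q_eval (q_binomial m b) (z powi e)
      = (if d dvd b then of_nat (gcd m (nat \<bar>e\<bar>) choose (b div d)) else 0)"
    using q_binomial_root_of_unity[OF primitive_root_of_unity_powi[OF z d], of "gcd m (nat \<bar>e\<bar>)" b] d
    by metis
  ultimately show ?thesis by simp
qed

section \<open>The two cyclic sieving triples\<close>

context two_row_ribbon
begin

lemma card_fixed_int_iterate:
  "card {T \<in> SYT S. int_iterate (SYT S) (promotion S) k T = T}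
    = card {T \<in> SYT S. (promotion S ^^ nat \<bar>k\<bar>) T = T}"
  by (rule arg_cong[of _ _ card]) (auto simp: int_iterate_fixed_iff[OF bij_betw_promotion])

text \<open>Rotation by a multiple of \<open>m\<close> fixes all words, arcs included, which
  accounts for the constants. Coprimality of \<open>m - 1\<close> and \<open>m\<close> reduces the
  condition on the long cycle to the exponent \<open>e\<close>.\<close>

lemma card_fixed_m_power:
  assumes \<xi>: "primitive_root_of_unity (m - 1) \<xi>"
  shows "of_nat (card {T \<in> SYT S. int_iterate (SYT S) (promotion S) (int m * e) T = T})
    = of_nat (m choose b) - of_nat m + q_eval (q_int (m - 1)) (\<xi> powi e)"
proof -
  let ?n = "nat \<bar>e\<bar>"
  have n: "nat \<bar>int m * e\<bar> = m * ?n" by (simp add: abs_mult nat_mult_distrib)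
  have "coprime (m - 1) m" using coprime_Suc_right_nat[of "m - 1"] m_pos by simp
  then have dvd: "(m - 1) dvd m * ?n \<longleftrightarrow> (m - 1) dvd ?n" by (simp add: coprime_dvd_mult_right_iff)
  have "{f \<in> words m b. shift (int (m * ?n)) f = f} = words m b"
    using shift_period_dvd[of "int m" _ "int (m * ?n)"] by (auto simp: words_def)
  then have "card {T \<in> SYT S. (promotion S ^^ (m * ?n)) T = T} + m
      = (if (m - 1) dvd ?n then m - 1 else 0) + (m choose b)"
    using card_promotion_fixed[of "m * ?n"] dvd by (simp add: card_words m_pos)
  then have "of_nat (card {T \<in> SYT S. (promotion S ^^ (m * ?n)) T = T} + m)
      = (of_nat ((if (m - 1) dvd ?n then m - 1 else 0) + (m choose b)) :: complex)"
    by (simp only:)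
  moreover have "q_eval (q_int (m - 1)) (\<xi> powi e) = of_nat (if (m - 1) dvd ?n then m - 1 else 0)"
    unfolding q_eval_q_int_primitive[OF \<xi>] by simp
  ultimately show ?thesis
    unfolding card_fixed_int_iterate n of_nat_add by (simp add: algebra_simps)
qed

text \<open>Modulo \<open>m\<close> the factor \<open>m - 1\<close> is -1, so a word is fixed iff
  rotation by \<open>e\<close> fixes it. The long cycle is always fixed pointwise, and
  \<open>q_int m\<close> counts the arcs to be removed.\<close>

lemma card_fixed_m_minus_1_power:
  assumes \<zeta>: "primitive_root_of_unity m \<zeta>"
  shows "of_nat (card {T \<in> SYT S. int_iterate (SYT S) (promotion S) (int (m - 1) * e) T = T})
    = q_eval (q_binomial m b) (\<zeta> powi e) - q_eval (q_int m) (\<zeta> powi e) + of_nat m - 1"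
proof -
  let ?n = "nat \<bar>e\<bar>"
  have n: "nat \<bar>int (m - 1) * e\<bar> = (m - 1) * ?n" by (simp add: abs_mult nat_mult_distrib)
  have "coprime m (m - 1)" using coprime_Suc_left_nat[of "m - 1"] m_pos by simp
  then have dvd: "m dvd (m - 1) * ?n \<longleftrightarrow> m dvd ?n" by (simp add: coprime_dvd_mult_right_iff)
  have sh: "shift (int ((m - 1) * ?n)) f = f \<longleftrightarrow> shift e f = f" if f: "f \<in> words m b" for f
  proof -
    have p: "shift (int (m * ?n)) f = f"
      using f shift_period_dvd[of "int m" f "int (m * ?n)"] by (simp add: words_def)
    have "int ((m - 1) * ?n) = - int ?n + int (m * ?n)"
      using m_pos by (simp add: of_nat_diff algebra_simps)
    then have "shift (int ((m - 1) * ?n)) f = shift (- int ?n) f"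
      using shift_period_add[OF p, of "- int ?n"] by (simp only:)
    then show ?thesis using shift_uminus_eq_iff[of e f] shift_uminus_eq_iff[of "int ?n" f]
      by (cases "0 \<le> e") simp_all
  qed
  then have "{f \<in> words m b. shift (int ((m - 1) * ?n)) f = f} = {f \<in> words m b. shift e f = f}"
    by blast
  then have "card {T \<in> SYT S. (promotion S ^^ ((m - 1) * ?n)) T = T} + (if m dvd ?n then m else 0)
      = (m - 1) + card {f \<in> words m b. shift e f = f}"
    using card_promotion_fixed[of "(m - 1) * ?n"] unfolding dvd by simp
  then have "of_nat (card {T \<in> SYT S. (promotion S ^^ ((m - 1) * ?n)) T = T} + (if m dvd ?n then m else 0))
      = (of_nat ((m - 1) + card {f \<in> words m b. shift e f = f}) :: complex)"
    by (simp only:)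
  moreover have "q_eval (q_int m) (\<zeta> powi e) = of_nat (if m dvd ?n then m else 0)"
    unfolding q_eval_q_int_primitive[OF \<zeta>] by simp
  ultimately show ?thesis
    unfolding card_fixed_int_iterate n of_nat_add card_words_fixed_eq_q_binomial[OF \<zeta>]
    using m_pos by (simp add: algebra_simps of_nat_diff)
qed

text \<open>By \<open>promotion_period\<close>, the condition \<open>n * k = m * (m - 1)\<close>
  makes the \<open>n\<close>-th power of the generator trivial. Iterates of the \<open>k\<close>-th
  power have the fixed points of promotion at \<open>k\<close> times the exponent, for either
  sign.\<close>

lemma csp_triple_promotion_power:
  assumes pos: "0 < k" "0 < n" and kn: "n * k = m * (m - 1)"
    and fixed: "\<And>z e. primitive_root_of_unity n z \<Longrightarrow>
      of_nat (card {T \<in> SYT S. int_iterate (SYT S) (promotion S) (int k * e) T = T}) = q_eval f (z powi e)"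
  shows "csp_triple (SYT S) (promotion S ^^ k) n f"
proof -
  have bij: "bij_betw (promotion S ^^ k) (SYT S) (SYT S)"
    using bij_betw_funpow[OF bij_betw_promotion] .
  have "int_iterate (SYT S) (promotion S ^^ k) e T = T \<longleftrightarrow>
      int_iterate (SYT S) (promotion S) (int k * e) T = T" if "T \<in> SYT S" for T e
    using that int_iterate_fixed_iff[OF bij] int_iterate_fixed_iff[OF bij_betw_promotion]
    by (simp add: funpow_mult abs_mult nat_mult_distrib)
  then have "{T \<in> SYT S. int_iterate (SYT S) (promotion S ^^ k) e T = T}
      = {T \<in> SYT S. int_iterate (SYT S) (promotion S) (int k * e) T = T}" for e
    by blast
  moreover have "((promotion S ^^ k) ^^ n) T = T" if "T \<in> SYT S" for T
    using promotion_period[OF that] kn by (simp add: funpow_mult mult.commute)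
  ultimately show ?thesis
    using finite_SYT pos bij fixed by (simp add: csp_triple_def)
qed

end

theorem mainTheorem14:
  fixes m b :: nat
  assumes "1 \<le> b" and "b \<le> m - 1"
  defines "X \<equiv> SYT_R (m - b) b"
    and "prom \<equiv> promotion (ribbon (m - b) b)"
  shows "bij_betw prom X X
    \<and> (\<exists>!A. A \<in> orbit prom ` X \<and> card A = m - 1)
    \<and> (\<forall>A \<in> orbit prom ` X. card A \<noteq> m - 1 \<longrightarrow> card A dvd m)
    \<and> (\<forall>\<xi>. primitive_root_of_unity (m - 1) \<xi> \<longrightarrow> (\<forall>e::int.
         of_nat (card {T \<in> X. int_iterate X prom (int m * e) T = T})
         = of_nat (m choose b) - of_nat m + q_eval (q_int (m - 1)) (\<xi> powi e)))
    \<and> (\<forall>\<zeta>. primitive_root_of_unity m \<zeta> \<longrightarrow> (\<forall>e::int.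
         of_nat (card {T \<in> X. int_iterate X prom (int (m - 1) * e) T = T})
         = q_eval (q_binomial m b) (\<zeta> powi e) - q_eval (q_int m) (\<zeta> powi e) + of_nat m - 1))
    \<and> csp_triple X (prom ^^ m) (m - 1) (of_nat (m choose b) - of_nat m + q_int (m - 1))
    \<and> csp_triple X (prom ^^ (m - 1)) m (q_binomial m b - q_int m + of_nat m - 1)"
proof -
  interpret two_row_ribbon m b
    using assms by unfold_locales auto
  have csp_m: "csp_triple (SYT S) (promotion S ^^ m) (m - 1)
      (of_nat (m choose b) - of_nat m + q_int (m - 1))"
    using b_pos b_less m_pos card_fixed_m_power
    by (intro csp_triple_promotion_power) (auto simp: mult.commute)
  have csp_m_minus_1: "csp_triple (SYT S) (promotion S ^^ (m - 1)) m
      (q_binomial m b - q_int m + of_nat m - 1)"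
    using b_pos b_less m_pos card_fixed_m_minus_1_power
    by (intro csp_triple_promotion_power) auto
  show ?thesis
    unfolding X_def prom_def
    by (intro conjI allI impI ballI bij_betw_promotion ex1_orbit_card orbit_card_dvd
        card_fixed_m_power card_fixed_m_minus_1_power csp_m csp_m_minus_1)
qed

end
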